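(* Let $d\ge 1$ and $m\ge 2$ be integers, and let $\mathcal{C}$ be the set of tuples $A=(A_1,\ldots,A_m)\in(\mathrm{GL}_d(\mathbb{R}))^m$ with $\|A_i\|<1$ for all $i\in\{1,\ldots,m\}$, with the topology induced from $(\mathbb{R}^{d\times d})^m$. Then the affinity dimension is a continuous function of the linear maps $(A_1,\ldots,A_m)$; that is, the function $\mathcal{C}\to(0,\infty)$ that assigns to $A$ its affinity dimension is continuous.
   Context: $\|\cdot\|$ is the Euclidean operator norm on $\mathbb{R}^{d\times d}$. For $B\in\mathrm{GL}_d(\mathbb{R})$ let $\alpha_1(B)\ge\cdots\ge\alpha_d(B)>0$ be its singular values. The singular value function (SVF) is defined as follows: for $0\le s<d$, with $k=\lfloor s\rfloor$, put $\phi^s(B)=\alpha_1(B)\cdots\alpha_k(B)\,\alpha_{k+1}(B)^{s-k}$; for $s\ge d$, put $\phi^s(B)=|\det B|^{s/d}$. Let $I=\{1,\ldots,m\}$. For $A=(A_1,\ldots,A_m)\in(\mathrm{GL}_d(\mathbb{R}))^m$ and a word $\mathtt{i}=(i_1\cdots i_n)\in I^n$, put $A(\mathtt{i})=A_{i_n}\cdots A_{i_1}$. The SVF topological pressure is $P(A,s)=\lim_{n\to\infty}\frac1n\log\sum_{\mathtt{i}\in I^n}\phi^s(A(\mathtt{i}))$ for $s\ge 0$ (the limit exists and is finite). If $\|A_i\|<1$ for all $i$ (and $m\ge 2$), the function $s\mapsto P(A,s)$ is continuous and strictly decreasing on $[0,\infty)$ and has a unique zero in $(0,\infty)$; this zero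 is called the affinity dimension of $A$. *)

theory Defs
  imports
    "HOL-Analysis.Analysis"
    "HOL-Computational_Algebra.Polynomial"
    "HOL-Library.Multiset"
begin

text \<open>
  Real \<open>d \<times> d\<close> matrices are elements of \<open>real ^ 'd ^ 'd\<close> with \<open>d = CARD('d)\<close>, and \<open>m\<close>-tuples of
  matrices are elements of \<open>(real ^ 'd ^ 'd) ^ 'm\<close> with \<open>m = CARD('m)\<close>, whose topology is the
  product topology. The index set \<open>I\<close> is the type \<open>'m\<close>; no ordering of it is used.
\<close>

definition charpoly :: "real ^ 'd ^ 'd \<Rightarrow> real poly" where
  "charpoly M = det (\<chi> i j. (if i = j then [:0, 1:] else 0) - [:M $ i $ j:])"

text \<open>
  The singular values of \<open>B\<close> are the square roots of the eigenvalues of \<open>B\<^sup>T B\<close>, counted with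
  multiplicity. As \<open>B\<^sup>T B\<close> is symmetric and positive semidefinite, its characteristic polynomial
  has \<open>d\<close> real, nonnegative roots with multiplicity, so the list below has length \<open>d\<close>; it is in
  nonincreasing order.
\<close>

definition singular_values :: "real ^ 'd ^ 'd \<Rightarrow> real list" where
  "singular_values B =
     rev (sorted_list_of_multiset (image_mset sqrt (proots (charpoly (transpose B ** B)))))"

text \<open>Indexed from 1: \<open>singular_value B i\<close> is \<open>\<alpha>\<^sub>i(B)\<close> for \<open>1 \<le> i \<le> d\<close>.\<close>

definition singular_value :: "real ^ 'd ^ 'd \<Rightarrow> nat \<Rightarrow> real" where
  "singular_value B i = singular_values B ! (i - 1)"

text \<open>Only meaningful for \<open>s \<ge> 0\<close> and invertible \<open>B\<close>, where every base of \<open>powr\<close> is positive.\<close>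

definition svf :: "real \<Rightarrow> real ^ 'd ^ 'd \<Rightarrow> real" where
  "svf s B =
     (if s < real CARD('d)
      then let k = nat \<lfloor>s\<rfloor> in
        (\<Prod>i = 1..k. singular_value B i) * singular_value B (k + 1) powr (s - real k)
      else \<bar>det B\<bar> powr (s / real CARD('d)))"

text \<open>The product is taken in reverse order: \<open>word_prod A [i\<^sub>1, \<dots>, i\<^sub>n] = A\<^bsub>i\<^sub>n\<^esub> \<cdots> A\<^bsub>i\<^sub>1\<^esub>\<close>.\<close>

fun word_prod :: "(real ^ 'd ^ 'd) ^ 'm \<Rightarrow> 'm list \<Rightarrow> real ^ 'd ^ 'd" where
  "word_prod A [] = mat 1"
| "word_prod A (i # w) = word_prod A w ** (A $ i)"

definition svf_pressure :: "(real ^ 'd ^ 'd) ^ 'm \<Rightarrow> real \<Rightarrow> real" where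
  "svf_pressure A s =
     lim (\<lambda>n. 1 / real n * ln (\<Sum>w | length w = n. svf s (word_prod A w)))"

definition affinity_dimension :: "(real ^ 'd ^ 'd) ^ 'm \<Rightarrow> real" where
  "affinity_dimension A = (THE s. 0 < s \<and> svf_pressure A s = 0)"

text \<open>The set \<open>\<C>\<close> of tuples of invertible matrices of Euclidean operator norm less than 1.\<close>

definition contracting_tuples :: "((real ^ 'd ^ 'd) ^ 'm) set" where
  "contracting_tuples = {A. \<forall>i. invertible (A $ i) \<and> onorm ((*v) (A $ i)) < 1}"

end

theory Submission
  imports Defs
begin

text \<open>
  Write \<open>P(A, s)\<close> for the pressure. Singular values of long products lie between two exponentially
  decaying bounds, so \<open>P(A, \<cdot>)\<close> is Lipschitz on \<open>[0, \<infinity>)\<close> and strictly decreasing; it starts at \<open>ln m > 0\<close> and tends to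
  \<open>-\<infinity>\<close>. Hence it has exactly one zero \<open>D(A)\<close>, and \<open>P(A, s)\<close> is negative or positive
  according to whether \<open>s\<close> lies above or below \<open>D(A)\<close>. Continuity of \<open>D\<close> at \<open>A\<close> therefore means: for
  all tuples \<open>A'\<close> near \<open>A\<close>, a given rational \<open>s > D(A)\<close> satisfies \<open>D(A') < s\<close>, and a given rational
  \<open>s < D(A)\<close> satisfies \<open>D(A') \<ge> s\<close>.

  Up to constant factors \<open>\<phi>\<^sup>s\<close> is a product of powers of the entry norms of two consecutive exterior
  powers. This model \<open>\<psi>\<close> is submultiplicative, so by Fekete's lemma \<open>P(A, s)\<close> is the infimum over
  \<open>n \<ge> 1\<close> of \<open>(1/n) ln Z\<^sub>n(A)\<close>, where \<open>Z\<^sub>n(A)\<close> is the sum of \<open>\<psi>\<close> over all words of length \<open>n\<close>. Every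
  \<open>Z\<^sub>n\<close> is continuous in \<open>A\<close>, so negativity of \<open>P(A, s)\<close> is an open condition on \<open>A\<close>. That settles the
  rational \<open>s > D(A)\<close>.

  The difficulty is to keep the pressure from dropping under perturbation. For rational \<open>s\<close> a tensor
  product of exterior powers turns \<open>\<psi>\<close> into \<open>g\<^sup>p\<close>, with \<open>p > 0\<close> and \<open>g\<close> the entry norm of a single matrix
  representation, of some dimension \<open>n\<close>. For such sums, and with a constant \<open>C\<close> depending only on \<open>n\<close>
  and \<open>p\<close>, one has
  \<open>Z\<^bsub>Nn\<^esub>(A) \<le> C Z\<^sub>N(A)\<^bsup>n-1\<^esup>\<close> for every \<open>N\<close>, as soon as the series \<open>\<Sum>\<^sub>k Z\<^sub>k(A)\<close> converges
  (\<open>word_sum_power_le_of_summable\<close>). This is a counterpart, for sums of \<open>p\<close>-th powers, of Bochi's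
  inequality for the joint spectral radius; that it yields continuity of the affinity dimension was
  observed by Morris. Negative pressure makes the series converge. If on the other hand
  \<open>P(A, s) > 0\<close>, then \<open>Z\<^bsub>Nn\<^esub>(A)\<close> grows like \<open>exp(N n P)\<close> and beats \<open>C Z\<^sub>N(A)\<^bsup>n-1\<^esup>\<close>, which grows like
  \<open>exp(N (n - 1) P)\<close>, for large \<open>N\<close>. The reverse strict inequality at one such \<open>N\<close> is an open
  condition, and it prevents the pressure of nearby tuples from being negative.

  The inequality is proved with the function
  \<open>f(x) = |x|\<^sup>p + \<Sum>\<^sub>u |X\<^sub>u x|\<^sup>p\<close>, where \<open>u\<close> runs over all words, \<open>X\<^sub>u\<close> is the represented product
  and \<open>|x|\<^sup>p\<close> stands for the sum of the \<open>p\<close>-th powers of the absolute values of the coordinates. The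
  sum of \<open>f(X\<^sub>w x)\<close> over the words \<open>w\<close> of one length is at most \<open>2 f(x)\<close>. In a basis of
  successive near-minimisers of \<open>f\<close> this bounds, by a constant, the sums of the \<open>p\<close>-th powers of all
  entries of the block matrices \<open>X\<^sub>w\<close> on or below the diagonal. A product of \<open>n\<close> matrices of size
  \<open>n\<close> cannot avoid such an entry: a strictly increasing path of \<open>n\<close> steps would need \<open>n + 1\<close> indices.
  One of the \<open>n\<close> factors thus contributes a constant and the others at most \<open>Z\<^sub>N(A)\<close> each.
\<close>

section \<open>Spectral theorem and singular value decomposition\<close>

lemma symmetric_matrix_inner:
  fixes S :: "real^'d^'d"
  assumes "transpose S = S" shows "x \<bullet> (S *v y) = y \<bullet> (S *v x)"
  by (metis assms dot_lmul_matrix inner_commute vector_transpose_matrix)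

text \<open>
  The frame maximises \<open>\<Sum>\<^sub>i c\<^sub>i \<langle>v\<^sub>i, S v\<^sub>i\<rangle>\<close> over all orthonormal frames, where the weights \<open>c\<^sub>i\<close> are
  pairwise distinct. Rotating \<open>v\<^sub>p\<close> and \<open>v\<^sub>q\<close> in their plane changes this with initial velocity
  \<open>2 (c\<^sub>p - c\<^sub>q) \<langle>v\<^sub>p, S v\<^sub>q\<rangle>\<close>, which therefore vanishes at a maximum.
\<close>

lemma ex_orthonormal_eigenframe:
  fixes S :: "real^'d::finite^'d"
  assumes sym: "transpose S = S"
  shows "\<exists>V :: real^'d^'d. orthogonal_matrix V \<and> (\<forall>p q. p \<noteq> q \<longrightarrow> row p V \<bullet> (S *v row q V) = 0)"
proof -
  obtain c :: "'d \<Rightarrow> nat" where c: "inj c"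
    using finite_imp_inj_to_nat_seg[of "UNIV :: 'd set"] by auto
  define T where "T = {V :: real^'d^'d. transpose V ** V = mat 1}"
  define g where "g V = (\<Sum>i\<in>UNIV. real (c i) * (V $ i \<bullet> (S *v (V $ i))))" for V :: "real^'d^'d"
  have row: "row i V = V $ i" for i and V :: "real^'d^'d" by (simp add: row_def vec_eq_iff)
  have T_iff: "V \<in> T \<longleftrightarrow> (\<forall>i j. V $ i \<bullet> V $ j = (if i = j then 1 else 0))" for V
  proof -
    have "V \<in> T \<longleftrightarrow> V ** transpose V = mat 1"
      by (simp add: T_def matrix_left_right_inverse)
    also have "\<dots> \<longleftrightarrow> (\<forall>i j. V $ i \<bullet> V $ j = (if i = j then 1 else 0))"
      by (simp add: vec_eq_iff[of "V ** transpose V"] vec_eq_iff matrix_mult_transpose_dot_row row mat_def)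
    finally show ?thesis .
  qed
  have "compact T"
  proof (rule compact_eq_bounded_closed[THEN iffD2], intro conjI)
    have "closed {V :: real^'d^'d. \<forall>i j. V $ i \<bullet> V $ j = (if i = j then 1 else 0)}"
      by (intro closed_Collect_all closed_Collect_eq continuous_intros)
    also have "{V :: real^'d^'d. \<forall>i j. V $ i \<bullet> V $ j = (if i = j then 1 else 0)} = T"
      using T_iff by blast
    finally show "closed T" .
    show "bounded T"
      unfolding bounded_iff
    proof (intro exI[of _ "sqrt (real CARD('d))"] ballI)
      fix V :: "real^'d^'d" assume "V \<in> T"
      then have "norm (V $ i) = 1" for i by (simp add: T_iff norm_eq_1)
      then show "norm V \<le> sqrt (real CARD('d))"
        by (simp add: norm_vec_def[of V] L2_set_def)
    qed
  qed
  moreover have "mat 1 \<in> T" by (simp add: T_def)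
  moreover have "continuous_on T g"
    unfolding g_def matrix_vector_mult_def
    by (intro continuous_intros)
  ultimately obtain V where V: "V \<in> T" and max: "\<And>W. W \<in> T \<Longrightarrow> g W \<le> g V"
    using continuous_attains_sup[of T g] by blast
  have "V $ p \<bullet> (S *v (V $ q)) = 0" if pq: "p \<noteq> q" for p q
  proof -
    \<comment> \<open>The frame \<open>V\<close> with rows \<open>p\<close> and \<open>q\<close> rotated by the angle \<open>\<theta>\<close> in their plane.\<close>
    define W where "W \<theta> = (\<chi> i. if i = p then cos \<theta> *\<^sub>R V $ p + sin \<theta> *\<^sub>R V $ q
        else if i = q then cos \<theta> *\<^sub>R V $ q - sin \<theta> *\<^sub>R V $ p else V $ i)" for \<theta>
    have W_simps: "W \<theta> $ p = cos \<theta> *\<^sub>R V $ p + sin \<theta> *\<^sub>R V $ q"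
      "W \<theta> $ q = cos \<theta> *\<^sub>R V $ q - sin \<theta> *\<^sub>R V $ p"
      "i \<noteq> p \<Longrightarrow> i \<noteq> q \<Longrightarrow> W \<theta> $ i = V $ i" for \<theta> i
      using pq by (auto simp: W_def)
    have on: "V $ i \<bullet> V $ j = (if i = j then 1 else 0)" for i j using V by (auto simp: T_iff)
    have cs: "cos \<theta> * cos \<theta> + sin \<theta> * sin \<theta> = 1" for \<theta> :: real
      using sin_cos_squared_add2[of \<theta>] by (simp add: power2_eq_square)
    have WT: "W \<theta> \<in> T" for \<theta>
      unfolding T_iff
    proof (intro allI)
      fix i j
      show "W \<theta> $ i \<bullet> W \<theta> $ j = (if i = j then 1 else 0)"
        using pq cs[of \<theta>]
        by (cases "i = p"; cases "i = q"; cases "j = p"; cases "j = q")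
          (auto simp: W_simps on inner_add_left inner_add_right inner_diff_left inner_diff_right)
    qed
    define a b e where "a = V $ p \<bullet> (S *v (V $ p))" "b = V $ q \<bullet> (S *v (V $ q))" "e = V $ p \<bullet> (S *v (V $ q))"
    note abe = this
    have e': "V $ q \<bullet> (S *v (V $ p)) = e" using symmetric_matrix_inner[OF sym] abe by metis
    define h where "h \<theta> = real (c p) * ((cos \<theta>)\<^sup>2 * a + 2 * cos \<theta> * sin \<theta> * e + (sin \<theta>)\<^sup>2 * b)
        + real (c q) * ((cos \<theta>)\<^sup>2 * b - 2 * cos \<theta> * sin \<theta> * e + (sin \<theta>)\<^sup>2 * a)" for \<theta>
    define R where "R = (\<Sum>i\<in>UNIV - {p, q}. real (c i) * (V $ i \<bullet> (S *v (V $ i))))"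
    have gW: "g (W \<theta>) = h \<theta> + R" for \<theta>
    proof -
      have "g (W \<theta>) = (\<Sum>i\<in>{p, q}. real (c i) * (W \<theta> $ i \<bullet> (S *v (W \<theta> $ i))))
          + (\<Sum>i\<in>UNIV - {p, q}. real (c i) * (W \<theta> $ i \<bullet> (S *v (W \<theta> $ i))))"
        unfolding g_def by (subst add.commute, rule sum.subset_diff) auto
      also have "(\<Sum>i\<in>UNIV - {p, q}. real (c i) * (W \<theta> $ i \<bullet> (S *v (W \<theta> $ i)))) = R"
        unfolding R_def by (intro sum.cong) (auto simp: W_simps)
      also have "(\<Sum>i\<in>{p, q}. real (c i) * (W \<theta> $ i \<bullet> (S *v (W \<theta> $ i)))) = h \<theta>"
        using pq by (simp add: W_simps h_def inner_add_left inner_add_right inner_diff_left inner_diff_right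
            matrix_vector_right_distrib matrix_vector_mult_diff_distrib
            matrix_vector_mult_scaleR e' power2_eq_square algebra_simps flip: abe)
      finally show ?thesis .
    qed
    have "W 0 = V" by (simp add: W_def vec_eq_iff)
    then have hmax: "h \<theta> \<le> h 0" for \<theta>
      using max[OF WT[of \<theta>]] gW[of \<theta>] gW[of 0] by simp
    have "(h has_real_derivative 2 * (real (c p) - real (c q)) * e) (at 0)"
      unfolding h_def by (auto intro!: derivative_eq_intros simp: algebra_simps)
    then have "2 * (real (c p) - real (c q)) * e = 0"
      by (rule DERIV_local_max[of _ _ _ 1]) (use hmax in auto)
    moreover have "c p \<noteq> c q" using c pq by (auto dest: injD)
    ultimately show ?thesis by (simp add: abe)
  qed
  then show ?thesis using V by (intro exI[of _ V]) (auto simp: row orthogonal_matrix T_def)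
qed

definition diag_mat :: "('d \<Rightarrow> 'a::zero) \<Rightarrow> 'a^'d^'d" where
  "diag_mat \<delta> = (\<chi> i j. if i = j then \<delta> i else 0)"

lemma mult_diag_mat: "(A ** diag_mat f) $ i $ j = A $ i $ j * f j"
  for A :: "'a::comm_semiring_1^'d::finite^'d"
proof -
  have "(\<Sum>k\<in>UNIV. A $ i $ k * (if k = j then f k else 0)) = (\<Sum>k\<in>UNIV. if k = j then A $ i $ j * f j else 0)"
    by (intro sum.cong) auto
  then show ?thesis by (simp add: diag_mat_def matrix_matrix_mult_def)
qed

lemma diag_mat_mult: "(diag_mat f ** A) $ i $ j = f i * A $ i $ j"
  for A :: "'a::comm_semiring_1^'d::finite^'d"
proof -
  have "(\<Sum>k\<in>UNIV. (if i = k then f i else 0) * A $ k $ j) = (\<Sum>k\<in>UNIV. if k = i then f i * A $ i $ j else 0)"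
    by (intro sum.cong) auto
  then show ?thesis by (simp add: diag_mat_def matrix_matrix_mult_def)
qed

lemma spectral_decomposition:
  fixes S :: "real^'d::finite^'d"
  assumes "transpose S = S"
  obtains V \<Lambda> where "orthogonal_matrix V" "S = transpose V ** diag_mat \<Lambda> ** V"
    "\<And>i. \<Lambda> i = row i V \<bullet> (S *v row i V)"
proof -
  from ex_orthonormal_eigenframe[OF assms] obtain V :: "real^'d^'d" where
    V: "orthogonal_matrix V" and d: "\<And>p q. p \<noteq> q \<Longrightarrow> row p V \<bullet> (S *v row q V) = 0" by blast
  define \<Lambda> where "\<Lambda> i = row i V \<bullet> (S *v row i V)" for i
  have "(V ** S ** transpose V) $ i $ j = row i V \<bullet> (S *v row j V)" for i j
  proof -
    have "(V ** S ** transpose V) $ i $ j = (V ** (S ** transpose V)) $ i $ j"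
      by (simp add: matrix_mul_assoc)
    also have "\<dots> = row i V \<bullet> (S *v row j V)"
      by (simp add: matrix_matrix_mult_def inner_vec_def matrix_vector_mult_def row_def transpose_def)
    finally show ?thesis .
  qed
  then have "V ** S ** transpose V = diag_mat \<Lambda>"
    using d by (auto simp: vec_eq_iff diag_mat_def \<Lambda>_def)
  then have "transpose V ** diag_mat \<Lambda> ** V = (transpose V ** V) ** S ** (transpose V ** V)"
    by (metis matrix_mul_assoc)
  then have "S = transpose V ** diag_mat \<Lambda> ** V"
    using V by (simp add: orthogonal_matrix)
  then show thesis using V \<Lambda>_def that by blast
qed

text \<open>
  Constant polynomials embed real matrices into polynomial matrices, where \<open>X - V\<^sup>T \<Lambda> V\<close> equals
  \<open>V\<^sup>T (X - \<Lambda>) V\<close> because \<open>X\<close> is scalar; the determinant is multiplicative there as well.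
\<close>

lemma charpoly_orthogonal_conj_diag:
  fixes V :: "real^'d::finite^'d"
  assumes "orthogonal_matrix V"
  shows "charpoly (transpose V ** diag_mat \<Lambda> ** V) = (\<Prod>i\<in>UNIV. [:- \<Lambda> i, 1:])"
proof -
  define L where "L M = (\<chi> i j. [:M $ i $ j:])" for M :: "real^'d^'d"
  have pC: "(\<Sum>k\<in>K. [:f k:]) = [:\<Sum>k\<in>K. f k:]" for f :: "'d \<Rightarrow> real" and K
    by (induction K rule: infinite_finite_induct) auto
  have L_mult: "L (A ** B) = L A ** L B" for A B
    by (simp add: L_def matrix_matrix_mult_def vec_eq_iff pC mult.commute)
  have L_1: "L (mat 1) = mat 1" by (auto simp: L_def mat_def vec_eq_iff one_pCons)
  have X: "charpoly M = det (diag_mat (\<lambda>_. [:0, 1:]) - L M)" for M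
    unfolding charpoly_def diag_mat_def L_def
    by (rule arg_cong[of _ _ det]) (simp add: vec_eq_iff)
  have scal: "A ** diag_mat (\<lambda>_. x) = diag_mat (\<lambda>_. x) ** A" for A :: "real poly^'d^'d" and x
    by (simp add: vec_eq_iff mult_diag_mat diag_mat_mult mult.commute)
  have diff_l: "A ** (B - C) = A ** B - A ** C" and diff_r: "(B - C) ** A = B ** A - C ** A"
    for A B C :: "real poly^'d^'d"
    by (simp_all add: matrix_matrix_mult_def vec_eq_iff right_diff_distrib left_diff_distrib sum_subtractf)
  have VV: "L (transpose V) ** L V = mat 1"
    using assms L_mult[of "transpose V" V] by (simp add: orthogonal_matrix L_1)
  have "charpoly (transpose V ** diag_mat \<Lambda> ** V)
      = det (L (transpose V) ** (diag_mat (\<lambda>_. [:0, 1:]) - L (diag_mat \<Lambda>)) ** L V)"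
  proof -
    have "L (transpose V) ** (diag_mat (\<lambda>_. [:0, 1:]) - L (diag_mat \<Lambda>)) ** L V
       = L (transpose V) ** diag_mat (\<lambda>_. [:0, 1:]) ** L V - L (transpose V ** diag_mat \<Lambda> ** V)"
      by (simp add: L_mult diff_l diff_r)
    also have "L (transpose V) ** diag_mat (\<lambda>_. [:0, 1:]) ** L V = diag_mat (\<lambda>_. [:0, 1:])"
      by (metis scal matrix_mul_assoc VV matrix_mul_rid)
    finally show ?thesis by (simp add: X)
  qed
  also have "\<dots> = det (L (transpose V) ** L V) * det (diag_mat (\<lambda>_. [:0, 1:]) - L (diag_mat \<Lambda>))"
    by (simp add: det_mul)
  also have "\<dots> = (\<Prod>i\<in>UNIV. [:- \<Lambda> i, 1:])"
    unfolding VV by (subst det_diagonal) (auto simp: diag_mat_def L_def det_diagonal)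
  finally show ?thesis .
qed

text \<open>
  Diagonalising \<open>B\<^sup>T B = V\<^sup>T \<delta>\<^sup>2 V\<close> forces \<open>U = B V\<^sup>T \<delta>\<^sup>-\<^sup>1\<close>. The rows of \<open>V\<close> realise the singular
  values as \<open>\<delta>\<^sub>i = |B v\<^sub>i|\<close> with unit vectors \<open>v\<^sub>i\<close>, which is how they are bounded later on.
\<close>

lemma singular_value_decomposition:
  fixes B :: "real^'d::finite^'d"
  assumes inv: "invertible B"
  obtains U V \<delta> where "orthogonal_matrix U" "orthogonal_matrix V" "B = U ** diag_mat \<delta> ** V"
    "\<And>i. 0 < \<delta> i" "\<And>i. \<delta> i = norm (B *v row i V)"
    "mset (singular_values B) = image_mset \<delta> (mset_set UNIV)"
proof -
  let ?S = "transpose B ** B"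
  have "transpose ?S = ?S" by (simp add: matrix_transpose_mul)
  from spectral_decomposition[OF this] obtain V \<Lambda> where
    V: "orthogonal_matrix V" and S: "?S = transpose V ** diag_mat \<Lambda> ** V"
    and L: "\<And>i. \<Lambda> i = row i V \<bullet> (?S *v row i V)" by blast
  define \<delta> where "\<delta> i = norm (B *v row i V)" for i
  have Ld: "\<Lambda> i = (\<delta> i)\<^sup>2" for i
    unfolding L \<delta>_def power2_norm_eq_inner
    by (metis dot_lmul_matrix inner_commute matrix_vector_mul_assoc vector_transpose_matrix)
  have nrow: "norm (row i V) = 1" for i
    using V by (simp add: orthogonal_matrix_orthonormal_rows)
  have dpos: "0 < \<delta> i" for i
  proof -
    have "B *v row i V \<noteq> 0"
      using inv nrow[of i] by (metis invertible_def matrix_left_invertible_ker norm_zero zero_neq_one)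
    then show ?thesis by (simp add: \<delta>_def)
  qed
  define U where "U = B ** transpose V ** diag_mat (\<lambda>i. 1 / \<delta> i)"
  have dm: "diag_mat f ** diag_mat g = diag_mat (\<lambda>i. f i * g i)" for f g :: "'d \<Rightarrow> real"
    by (simp add: vec_eq_iff mult_diag_mat) (simp add: diag_mat_def)
  have d1: "diag_mat (\<lambda>_. 1) = mat 1" by (simp add: diag_mat_def mat_def)
  have dT: "transpose (diag_mat f) = diag_mat f" for f :: "'d \<Rightarrow> real"
    by (auto simp: transpose_def diag_mat_def vec_eq_iff)
  have VV: "V ** transpose V = mat 1" "transpose V ** V = mat 1"
    using V by (simp_all add: orthogonal_matrix_def)
  have "transpose U ** U = diag_mat (\<lambda>i. 1 / \<delta> i) ** (V ** ?S ** transpose V) ** diag_mat (\<lambda>i. 1 / \<delta> i)"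
    by (simp add: U_def matrix_transpose_mul dT matrix_mul_assoc)
  also have "V ** ?S ** transpose V = (V ** transpose V) ** diag_mat \<Lambda> ** (V ** transpose V)"
    unfolding S by (simp add: matrix_mul_assoc)
  also have "\<dots> = diag_mat \<Lambda>" by (simp add: VV)
  also have "diag_mat (\<lambda>i. 1 / \<delta> i) ** diag_mat \<Lambda> ** diag_mat (\<lambda>i. 1 / \<delta> i) = mat 1"
    unfolding dm d1[symmetric] using dpos
    by (intro arg_cong[of _ _ diag_mat] ext) (simp add: Ld power2_eq_square less_imp_neq[symmetric])
  finally have U: "orthogonal_matrix U" by (simp add: orthogonal_matrix)
  have "U ** diag_mat \<delta> ** V = B ** transpose V ** (diag_mat (\<lambda>i. 1 / \<delta> i) ** diag_mat \<delta>) ** V"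
    by (simp add: U_def matrix_mul_assoc)
  also have "diag_mat (\<lambda>i. 1 / \<delta> i) ** diag_mat \<delta> = mat 1"
    unfolding dm d1[symmetric] using dpos
    by (intro arg_cong[of _ _ diag_mat] ext) (simp add: less_imp_neq[symmetric])
  also have "B ** transpose V ** mat 1 ** V = B"
    by (simp add: VV flip: matrix_mul_assoc)
  finally have B: "B = U ** diag_mat \<delta> ** V" ..
  have "proots (charpoly ?S) = (\<Sum>i\<in>UNIV. {#\<Lambda> i#})"
    unfolding S charpoly_orthogonal_conj_diag[OF V] by (subst proots_prod) auto
  also have "\<dots> = image_mset \<Lambda> (mset_set UNIV)"
    by (induction rule: finite_induct[OF finite[of UNIV]]) auto
  finally have "mset (singular_values B) = image_mset sqrt (image_mset \<Lambda> (mset_set UNIV))"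
    by (simp add: singular_values_def)
  also have "\<dots> = image_mset \<delta> (mset_set UNIV)"
    using dpos by (simp add: image_mset.compositionality o_def Ld less_imp_le)
  finally show thesis using that U V B dpos \<delta>_def by blast
qed

text \<open>
  Of all \<open>k\<close>-element products of a nonincreasing sequence the first \<open>k\<close> terms give the largest. The
  largest index of \<open>T\<close> is at least \<open>card T - 1\<close>, so induction can strip off that index.
\<close>

lemma prod_le_prod_initial_segment:
  fixes a :: "nat \<Rightarrow> real"
  assumes "T \<subseteq> {..<d}" "\<And>i j. i \<le> j \<Longrightarrow> j < d \<Longrightarrow> a j \<le> a i" "\<And>i. i < d \<Longrightarrow> 0 < a i"
  shows "(\<Prod>t\<in>T. a t) \<le> (\<Prod>t<card T. a t)"
  using assms(1)
proof (induction "card T" arbitrary: T)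
  case 0
  then show ?case using finite_subset by fastforce
next
  case (Suc k)
  have fin: "finite T" using Suc.prems finite_subset by blast
  define M where "M = Max T"
  have ne: "T \<noteq> {}" using Suc by auto
  then have M: "M \<in> T" using fin by (simp add: M_def)
  have "T \<subseteq> {..M}" using fin by (auto simp: M_def)
  from card_mono[OF _ this] have "k \<le> M" using Suc by simp
  then have "a M \<le> a k" using M Suc.prems by (intro assms(2)) auto
  moreover have "(\<Prod>t\<in>T - {M}. a t) \<le> (\<Prod>t<k. a t)"
    using Suc M fin by (metis Diff_subset card_Diff_singleton diff_Suc_1 subset_trans)
  moreover have "0 \<le> (\<Prod>t\<in>T - {M}. a t)"
    using Suc.prems assms(3) by (intro prod_nonneg) (auto intro!: less_imp_le)
  moreover have "M < d" using M Suc.prems by auto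
  ultimately have "a M * (\<Prod>t\<in>T - {M}. a t) \<le> a k * (\<Prod>t<k. a t)"
    using assms(3) \<open>k \<le> M\<close> by (intro mult_mono) (auto intro: less_imp_le)
  then show ?case
    using fin M Suc(2) by (simp add: prod.remove mult.commute flip: Suc(2))
qed

lemma singular_value_decomposition_sorted:
  fixes B :: "real^'d::finite^'d"
  assumes "invertible B"
  obtains U V \<delta> e where "orthogonal_matrix U" "orthogonal_matrix V" "B = U ** diag_mat \<delta> ** V"
    "\<And>i. 0 < \<delta> i" "\<And>i. \<delta> i = norm (B *v row i V)"
    "bij_betw e {..<CARD('d)} UNIV" "\<And>r. r < CARD('d) \<Longrightarrow> singular_value B (Suc r) = \<delta> (e r)"
    "\<And>r s. r \<le> s \<Longrightarrow> s < CARD('d) \<Longrightarrow> \<delta> (e s) \<le> \<delta> (e r)"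
proof -
  from singular_value_decomposition[OF assms] obtain U V \<delta> where
    *: "orthogonal_matrix U" "orthogonal_matrix V" "B = U ** diag_mat \<delta> ** V"
    "\<And>i. 0 < \<delta> i" "\<And>i. \<delta> i = norm (B *v row i V)"
    and ms: "mset (singular_values B) = image_mset \<delta> (mset_set UNIV)" by blast
  obtain xs :: "'d list" where xs: "set xs = UNIV" "distinct xs"
    using finite_distinct_list[OF finite[of "UNIV :: 'd set"]] by auto
  define ys where "ys = rev (sort_key \<delta> xs)"
  have len: "length ys = CARD('d)" using xs distinct_card[of xs] by (simp add: ys_def)
  have "mset xs = mset_set UNIV" using xs mset_set_set by metis
  then have "mset (map \<delta> (sort_key \<delta> xs)) = mset (rev (singular_values B))"
    using ms by simp
  moreover have "sorted (map \<delta> (sort_key \<delta> xs))" by simp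
  ultimately have "sort (rev (singular_values B)) = map \<delta> (sort_key \<delta> xs)"
    by (rule properties_for_sort)
  moreover have sorted: "sorted (rev (singular_values B))" by (simp add: singular_values_def)
  ultimately have "rev (singular_values B) = map \<delta> (sort_key \<delta> xs)"
    by (simp add: sorted_sort_id)
  then have sv: "singular_values B = map \<delta> ys"
    unfolding ys_def by (metis rev_map rev_rev_ident)
  have "bij_betw (\<lambda>r. ys ! r) {..<CARD('d)} UNIV"
    using bij_betw_nth[of ys "{..<CARD('d)}" UNIV] xs len by (simp add: ys_def)
  moreover have "singular_value B (Suc r) = \<delta> (ys ! r)" if "r < CARD('d)" for r
    using that len by (simp add: singular_value_def sv)
  moreover have "\<delta> (ys ! s) \<le> \<delta> (ys ! r)" if "r \<le> s" "s < CARD('d)" for r s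
    using sorted_rev_nth_mono[OF sorted that(1)] that len by (simp add: sv)
  ultimately show thesis using * that by blast
qed

lemma singular_value_bounds:
  fixes B :: "real^'d::finite^'d"
  assumes "invertible B" "r < CARD('d)"
    and "\<And>x. norm x = 1 \<Longrightarrow> l \<le> norm (B *v x)" "\<And>x. norm x = 1 \<Longrightarrow> norm (B *v x) \<le> u"
  shows "l \<le> singular_value B (Suc r)" "singular_value B (Suc r) \<le> u"
proof -
  from singular_value_decomposition_sorted[OF assms(1)] obtain U V \<delta> e where
    V: "orthogonal_matrix (V :: real^'d^'d)" "\<And>i. \<delta> i = norm (B *v row i V)"
    "\<And>r. r < CARD('d) \<Longrightarrow> singular_value B (Suc r) = \<delta> (e r)" by metis
  have "norm (row i V) = 1" for i using V(1) by (simp add: orthogonal_matrix_orthonormal_rows)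
  then show "l \<le> singular_value B (Suc r)" "singular_value B (Suc r) \<le> u"
    using V(2,3) assms by auto
qed

lemma singular_value_pos:
  fixes B :: "real^'d::finite^'d"
  assumes "invertible B" "r < CARD('d)" shows "0 < singular_value B (Suc r)"
  using singular_value_decomposition_sorted[OF assms(1)] assms(2) by metis

lemma abs_det_eq_prod_singular_value:
  fixes B :: "real^'d::finite^'d"
  assumes "invertible B" shows "\<bar>det B\<bar> = (\<Prod>i<CARD('d). singular_value B (Suc i))"
proof -
  from singular_value_decomposition_sorted[OF assms] obtain U V \<delta> e where
    *: "orthogonal_matrix U" "orthogonal_matrix V" "B = U ** diag_mat \<delta> ** V"
    "\<And>i. 0 < \<delta> i" and
    e: "bij_betw e {..<CARD('d)} UNIV" "\<And>r. r < CARD('d) \<Longrightarrow> singular_value B (Suc r) = \<delta> (e r)"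
    by metis
  have "\<bar>det U\<bar> = 1" "\<bar>det V\<bar> = 1"
    using det_orthogonal_matrix[OF *(1)] det_orthogonal_matrix[OF *(2)] by auto
  then have "\<bar>det B\<bar> = \<bar>det (diag_mat \<delta>)\<bar>" by (simp add: *(3) det_mul abs_mult)
  also have "det (diag_mat \<delta>) = (\<Prod>i\<in>UNIV. \<delta> i)"
    by (subst det_diagonal) (auto simp: diag_mat_def)
  also have "\<bar>\<dots>\<bar> = (\<Prod>i\<in>UNIV. \<delta> i)"
    using *(4) by (simp add: abs_of_pos prod_pos)
  also have "\<dots> = (\<Prod>i<CARD('d). \<delta> (e i))"
    by (rule prod.reindex_bij_betw[OF e(1), symmetric])
  also have "\<dots> = (\<Prod>i<CARD('d). singular_value B (Suc i))"
    using e(2) by (intro prod.cong) auto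
  finally show ?thesis .
qed

section \<open>The singular value function in the exponent\<close>

text \<open>
  The exponent of \<open>\<alpha>\<^bsub>i+1\<^esub>\<close> in \<open>\<phi>\<^sup>s\<close>. It is nondecreasing in \<open>s\<close>, and the \<open>d\<close> exponents add up to \<open>s\<close>; this
  treats integer breakpoints and the regime \<open>s \<ge> d\<close> uniformly.
\<close>

definition svf_exponent :: "nat \<Rightarrow> real \<Rightarrow> nat \<Rightarrow> real" where
  "svf_exponent d s i = (if s < real d then max 0 (min 1 (s - real i)) else s / real d)"

lemma svf_exponent_mono: "0 \<le> s \<Longrightarrow> s \<le> t \<Longrightarrow> svf_exponent d s i \<le> svf_exponent d t i"
proof (cases "s < real d \<and> \<not> t < real d")
  case True
  assume "0 \<le> s" "s \<le> t"
  with True have "1 \<le> t / real d" by (simp add: le_divide_eq_1)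
  moreover have "svf_exponent d s i \<le> 1" using True by (simp add: svf_exponent_def)
  ultimately show ?thesis using True by (simp add: svf_exponent_def)
qed (auto simp: svf_exponent_def divide_right_mono)

lemma svf_eq_prod:
  fixes B :: "real^'d::finite^'d"
  assumes "invertible B" "0 \<le> s"
  shows "svf s B = (\<Prod>i<CARD('d). singular_value B (Suc i) powr svf_exponent CARD('d) s i)"
proof (cases "s < real CARD('d)")
  case True
  define k where "k = nat \<lfloor>s\<rfloor>"
  have k: "real k \<le> s" "s < real k + 1" using assms(2) by (auto simp: k_def)
  then have kd: "k < CARD('d)" using True by linarith
  have "{..<CARD('d)} = {..<k} \<union> {k} \<union> {k<..<CARD('d)}" using kd by auto
  then have "(\<Prod>i<CARD('d). singular_value B (Suc i) powr svf_exponent CARD('d) s i)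
     = (\<Prod>i\<in>{..<k} \<union> {k}. singular_value B (Suc i) powr svf_exponent CARD('d) s i) *
       (\<Prod>i\<in>{k<..<CARD('d)}. singular_value B (Suc i) powr svf_exponent CARD('d) s i)"
    by (simp add: prod.union_disjoint[symmetric] Int_def)
  also have "(\<Prod>i\<in>{k<..<CARD('d)}. singular_value B (Suc i) powr svf_exponent CARD('d) s i) = 1"
  proof (intro prod.neutral ballI)
    fix i assume "i \<in> {k<..<CARD('d)}"
    then have "svf_exponent CARD('d) s i = 0" using True k by (auto simp: svf_exponent_def)
    then show "singular_value B (Suc i) powr svf_exponent CARD('d) s i = 1"
      using singular_value_pos[OF assms(1), of i] \<open>i \<in> _\<close> by simp
  qed
  also have "(\<Prod>i\<in>{..<k} \<union> {k}. singular_value B (Suc i) powr svf_exponent CARD('d) s i)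
     = (\<Prod>i<k. singular_value B (Suc i) powr svf_exponent CARD('d) s i) *
       singular_value B (Suc k) powr svf_exponent CARD('d) s k"
    by simp
  also have "svf_exponent CARD('d) s k = s - real k"
    using True k by (simp add: svf_exponent_def)
  also have "(\<Prod>i<k. singular_value B (Suc i) powr svf_exponent CARD('d) s i)
      = (\<Prod>i<k. singular_value B (Suc i))"
  proof (intro prod.cong refl)
    fix i assume "i \<in> {..<k}"
    then have "i < k" by simp
    then have "svf_exponent CARD('d) s i = 1" using True k by (auto simp: svf_exponent_def)
    then show "singular_value B (Suc i) powr svf_exponent CARD('d) s i = singular_value B (Suc i)"
      using singular_value_pos[OF assms(1), of i] \<open>i < k\<close> kd by simp
  qed
  also have "\<dots> = (\<Prod>i = 1..k. singular_value B i)"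
    by (rule prod.reindex_bij_witness[where i = "\<lambda>i. i - 1" and j = Suc]) auto
  finally show ?thesis using True by (simp add: svf_def k_def Let_def)
next
  case False
  have "svf s B = (\<Prod>i<CARD('d). singular_value B (Suc i)) powr (s / real CARD('d))"
    using False by (simp add: svf_def abs_det_eq_prod_singular_value[OF assms(1)])
  also have "\<dots> = (\<Prod>i<CARD('d). singular_value B (Suc i) powr (s / real CARD('d)))"
    by (rule prod_powr_distrib)
  finally show ?thesis using False by (simp add: svf_exponent_def)
qed

lemma sum_svf_exponent:
  assumes "0 \<le> s" "d > 0"
  shows "(\<Sum>i<d. svf_exponent d s i) = s"
proof (cases "s < real d")
  case True
  define k where "k = nat \<lfloor>s\<rfloor>"
  have k: "real k \<le> s" "s < real k + 1" using assms(1) by (auto simp: k_def)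
  then have kd: "k < d" using True by linarith
  have "{..<d} = {..<k} \<union> {k} \<union> {k<..<d}" using kd by auto
  then have "(\<Sum>i<d. svf_exponent d s i)
     = (\<Sum>i\<in>{..<k} \<union> {k}. svf_exponent d s i) + (\<Sum>i\<in>{k<..<d}. svf_exponent d s i)"
    by (simp add: sum.union_disjoint[symmetric] Int_def)
  also have "(\<Sum>i\<in>{k<..<d}. svf_exponent d s i) = 0"
    using True k by (intro sum.neutral) (auto simp: svf_exponent_def)
  also have "(\<Sum>i\<in>{..<k} \<union> {k}. svf_exponent d s i) = (\<Sum>i<k. svf_exponent d s i) + (s - real k)"
    using True k by (simp add: svf_exponent_def)
  also have "(\<Sum>i<k. svf_exponent d s i) = (\<Sum>i<k. 1)"
    using True k by (intro sum.cong) (auto simp: svf_exponent_def)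
  finally show ?thesis by simp
qed (use assms in \<open>auto simp: svf_exponent_def\<close>)

lemma svf_pos:
  fixes B :: "real^'d::finite^'d"
  assumes "invertible B" "0 \<le> s" shows "0 < svf s B"
  unfolding svf_eq_prod[OF assms] using singular_value_pos[OF assms(1)]
  by (intro prod_pos) (metis lessThan_iff powr_gt_zero less_imp_neq)

text \<open>
  The quotient \<open>\<phi>\<^sup>s\<^sup>+\<^sup>t(B) / \<phi>\<^sup>s(B)\<close> is a product of powers of singular values whose exponents are
  nonnegative and have sum \<open>t\<close>.
\<close>

lemma svf_add_bounds:
  fixes B :: "real^'d::finite^'d"
  assumes inv: "invertible B" and s: "0 \<le> s" "0 \<le> t" and l: "0 < l"
    and lB: "\<And>x. norm x = 1 \<Longrightarrow> l \<le> norm (B *v x)" and uB: "\<And>x. norm x = 1 \<Longrightarrow> norm (B *v x) \<le> u"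
  shows "l powr t * svf s B \<le> svf (s + t) B" "svf (s + t) B \<le> u powr t * svf s B"
proof -
  let ?d = "CARD('d)"
  define a where "a i = singular_value B (Suc i)" for i
  have a: "0 < a i" "l \<le> a i" "a i \<le> u" if "i < ?d" for i
    unfolding a_def using singular_value_bounds[OF inv that lB uB] singular_value_pos[OF inv that] by auto
  then have u: "0 < u" using l by (metis order_less_le_trans zero_less_card_finite)
  define e where "e i = svf_exponent ?d (s + t) i - svf_exponent ?d s i" for i
  have e: "0 \<le> e i" for i using svf_exponent_mono[of s "s + t" ?d i] s by (simp add: e_def)
  have esum: "(\<Sum>i<?d. e i) = t"
    using sum_svf_exponent[of "s + t" ?d] sum_svf_exponent[of s ?d] s by (simp add: e_def sum_subtractf)
  have "svf (s + t) B = (\<Prod>i<?d. a i powr e i * a i powr svf_exponent ?d s i)"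
    using s by (subst svf_eq_prod[OF inv]) (auto simp: e_def a_def powr_add[symmetric])
  also have "\<dots> = (\<Prod>i<?d. a i powr e i) * svf s B"
    using s by (subst svf_eq_prod[OF inv]) (auto simp: a_def prod.distrib)
  finally have eq: "svf (s + t) B = (\<Prod>i<?d. a i powr e i) * svf s B" .
  have "l powr t = (\<Prod>i<?d. l powr e i)" "u powr t = (\<Prod>i<?d. u powr e i)"
    unfolding esum[symmetric] using l u by (auto intro!: powr_sum)
  moreover have "(\<Prod>i<?d. l powr e i) \<le> (\<Prod>i<?d. a i powr e i)"
    using a e l by (intro prod_mono) (auto intro!: powr_mono2)
  moreover have "(\<Prod>i<?d. a i powr e i) \<le> (\<Prod>i<?d. u powr e i)"
    using a e l by (intro prod_mono) (auto intro!: powr_mono2 less_imp_le[OF a(1)])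
  ultimately show "l powr t * svf s B \<le> svf (s + t) B" "svf (s + t) B \<le> u powr t * svf s B"
    unfolding eq using svf_pos[OF inv s(1)] by (auto intro!: mult_right_mono)
qed

lemma svf_0: "invertible B \<Longrightarrow> svf 0 B = 1" for B :: "real^'d::finite^'d"
  using singular_value_pos[of B 0] by (simp add: svf_def)

section \<open>Bases adapted to a homogeneous function\<close>

lemma abs_sum_powr_le:
  fixes x :: "'k \<Rightarrow> real"
  assumes "finite K" "p > 0"
  shows "\<bar>\<Sum>k\<in>K. x k\<bar> powr p \<le> real (card K) powr p * (\<Sum>k\<in>K. \<bar>x k\<bar> powr p)"
proof (cases "K = {}")
  case False
  define M where "M = Max ((\<lambda>k. \<bar>x k\<bar>) ` K)"
  have le: "\<bar>x k\<bar> \<le> M" if "k \<in> K" for k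
    using assms that by (auto simp: M_def)
  have "M \<in> (\<lambda>k. \<bar>x k\<bar>) ` K"
    unfolding M_def using assms False by (intro Max_in) auto
  then obtain k0 where k0: "k0 \<in> K" "M = \<bar>x k0\<bar>" by auto
  have "\<bar>\<Sum>k\<in>K. x k\<bar> \<le> (\<Sum>k\<in>K. \<bar>x k\<bar>)" by (rule sum_abs)
  also have "\<dots> \<le> real (card K) * M"
    using le by (rule sum_bounded_above)
  finally have "\<bar>\<Sum>k\<in>K. x k\<bar> powr p \<le> (real (card K) * M) powr p"
    using assms by (intro powr_mono2) auto
  also have "\<dots> = real (card K) powr p * \<bar>x k0\<bar> powr p"
    using k0 by (simp add: powr_mult)
  also have "\<dots> \<le> real (card K) powr p * (\<Sum>k\<in>K. \<bar>x k\<bar> powr p)"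
    using k0 assms by (intro mult_left_mono member_le_sum) auto
  finally show ?thesis .
qed (use assms in auto)

lemma abs_add_powr_le:
  fixes a b :: real
  assumes "p > 0"
  shows "\<bar>a + b\<bar> powr p \<le> 2 powr p * (\<bar>a\<bar> powr p + \<bar>b\<bar> powr p)"
  using abs_sum_powr_le[of "UNIV :: bool set" p "\<lambda>t. if t then a else b"] assms
  by (simp add: UNIV_bool add.commute)

text \<open>
  The \<open>p\<close>-th powers of quasi-norms that dominate the coordinates in \<open>P\<close>.
\<close>

definition quasi_power :: "real \<Rightarrow> real \<Rightarrow> 'a set \<Rightarrow> (('a \<Rightarrow> real) \<Rightarrow> real) \<Rightarrow> bool" where
  "quasi_power p K P f \<longleftrightarrow>
     (\<forall>c x. f (\<lambda>r. c * x r) = \<bar>c\<bar> powr p * f x) \<and>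
     (\<forall>x y. f (\<lambda>r. x r + y r) \<le> K * (f x + f y)) \<and>
     (\<forall>x. \<forall>r\<in>P. \<bar>x r\<bar> powr p \<le> f x) \<and> (\<forall>x. 0 \<le> f x)"

text \<open>
  A basis \<open>v\<close> of the vectors supported in \<open>P\<close>, with coordinate functionals whose coefficients form
  \<open>\<gamma>\<close>. The last conjunct expresses that the sizes \<open>f(v\<^sub>0), f(v\<^sub>1), \<dots>\<close> are essentially nondecreasing and that
  \<open>f\<close> is comparable from below to its largest term \<open>f(v\<^sub>i) |x\<^sub>i|\<^sup>p\<close>, where \<open>x\<^sub>i\<close> is the \<open>i\<close>-th coordinate of
  \<open>x\<close>.
\<close>

definition adapted_basis ::
  "real \<Rightarrow> real \<Rightarrow> (('a \<Rightarrow> real) \<Rightarrow> real) \<Rightarrow> 'a set \<Rightarrow> (nat \<Rightarrow> 'a \<Rightarrow> real) \<Rightarrow> (nat \<Rightarrow> 'a \<Rightarrow> real) \<Rightarrow> bool"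
  where
  "adapted_basis p C f P v \<gamma> \<longleftrightarrow>
     (\<forall>i<card P. (\<forall>r. r \<notin> P \<longrightarrow> v i r = 0) \<and> (\<forall>r\<in>P. \<bar>v i r\<bar> \<le> C \<and> \<bar>\<gamma> i r\<bar> \<le> C) \<and> 0 < f (v i)) \<and>
     (\<forall>x. (\<forall>r. r \<notin> P \<longrightarrow> x r = 0) \<longrightarrow>
        (\<forall>r. x r = (\<Sum>i<card P. (\<Sum>t\<in>P. \<gamma> i t * x t) * v i r)) \<and>
        (\<forall>i<card P. \<forall>j\<le>i. f (v j) * \<bar>\<Sum>t\<in>P. \<gamma> i t * x t\<bar> powr p \<le> C * f x))"

text \<open>
  Successive minima: \<open>v\<^sub>0\<close> minimises \<open>f\<close> up to a factor 2 among the vectors having some coordinate equal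
  to 1, say coordinate \<open>a\<close>. Subtracting \<open>x\<^sub>a v\<^sub>0\<close> from \<open>x\<close> costs only a constant factor in \<open>f\<close> and removes
  coordinate \<open>a\<close>, so the remaining vectors come from the induction hypothesis for \<open>P - {a}\<close>. The
  constant depends only on \<open>p\<close>, \<open>K\<close> and the dimension \<open>m\<close>, never on \<open>f\<close>; everything later rests on
  this uniformity.
\<close>

lemma ex_adapted_basis:
  fixes p K :: real
  assumes p: "p > 0" and K: "K \<ge> 1"
  shows "\<exists>C\<ge>1. \<forall>f P. finite (P :: 'a set) \<and> card P = m \<and> quasi_power p K P f \<longrightarrow>
           (\<exists>v \<gamma>. adapted_basis p C f P v \<gamma>)"
proof (induction m)
  case 0
  show ?case
    by (rule exI[of _ 1]) (auto simp: adapted_basis_def)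
next
  case (Suc m)
  then obtain C0 where C0: "C0 \<ge> 1"
    and IH: "\<And>f P. finite (P :: 'a set) \<Longrightarrow> card P = m \<Longrightarrow> quasi_power p K P f \<Longrightarrow>
           \<exists>v \<gamma>. adapted_basis p C0 f P v \<gamma>" by metis
  \<comment> \<open>\<open>b\<close> bounds the coordinates of the near-minimiser \<open>v0\<close>; the other constants collect the bounds of the
    individual cases below.\<close>
  define b :: real where "b = 2 powr (1 / p)"
  have b: "b \<ge> 1" unfolding b_def using p by (intro ge_one_powr_ge_zero) auto
  define D where "D = real m powr p * (real m * C0 powr p) * (6 * K)"
  have D: "D \<ge> 0" unfolding D_def using K by auto
  define C where "C = 2 + b + C0 + real m * C0 * b + 3 * K * C0 + D"
  have nn: "real m * C0 * b \<ge> 0" "K * C0 \<ge> 0" using b C0 K by auto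
  have C: "C \<ge> 2" "C \<ge> b" "C \<ge> C0" "C \<ge> real m * C0 * b" "C \<ge> 3 * K * C0" "C \<ge> D"
    unfolding C_def using b C0 D nn by linarith+
  have "\<exists>v \<gamma>. adapted_basis p C f P v \<gamma>"
    if fin: "finite P" and card: "card P = Suc m" and q: "quasi_power p K P f" for f and P :: "'a set"
  proof -
    have hom: "f (\<lambda>r. c * x r) = \<bar>c\<bar> powr p * f x" for c x using q by (auto simp: quasi_power_def)
    have tri: "f (\<lambda>r. x r + y r) \<le> K * (f x + f y)" for x y using q by (auto simp: quasi_power_def)
    have dom: "r \<in> P \<Longrightarrow> \<bar>x r\<bar> powr p \<le> f x" for x r using q by (auto simp: quasi_power_def)
    have nonneg: "0 \<le> f x" for x using q by (auto simp: quasi_power_def)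
    define V where "V = {x. \<forall>r. r \<notin> P \<longrightarrow> x r = (0::real)}"
    define S where "S = f ` {x \<in> V. \<exists>a\<in>P. x a = 1}"
    define I where "I = Inf S"
    obtain a0 where a0: "a0 \<in> P" using card by fastforce
    have "f (\<lambda>r. if r = a0 then 1 else 0) \<in> S"
      unfolding S_def using a0 by (intro imageI) (auto simp: V_def)
    then have S_ne: "S \<noteq> {}" by auto
    have S_ge: "1 \<le> y" if "y \<in> S" for y
    proof -
      from that obtain x a where "y = f x" "a \<in> P" "x a = 1" unfolding S_def by auto
      then show ?thesis using dom[of a x] by simp
    qed
    have I1: "I \<ge> 1" unfolding I_def using S_ne S_ge by (rule cInf_greatest)
    then have "Inf S < 2 * I" unfolding I_def by linarith
    from cInf_lessD[OF S_ne this] obtain v0 a where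
      v0: "v0 \<in> V" "a \<in> P" "v0 a = 1" "f v0 < 2 * I" unfolding S_def by auto
    \<comment> \<open>Dividing \<open>x\<close> by its coordinate \<open>x r\<close> yields a competitor for the infimum \<open>I\<close>.\<close>
    have I_le: "I * \<bar>x r\<bar> powr p \<le> f x" if "x \<in> V" "r \<in> P" for x r
    proof (cases "x r = 0")
      case True then show ?thesis using nonneg p by simp
    next
      case False
      have "f (\<lambda>t. (1 / x r) * x t) \<in> S"
        unfolding S_def using that False by (intro imageI) (auto simp: V_def)
      then have "I \<le> f (\<lambda>t. (1 / x r) * x t)"
        unfolding I_def by (intro cInf_lower bdd_belowI[of _ 1] S_ge)
      also have "\<dots> = \<bar>1 / x r\<bar> powr p * f x" by (rule hom)
      finally have "I * \<bar>x r\<bar> powr p \<le> (\<bar>1 / x r\<bar> powr p * f x) * \<bar>x r\<bar> powr p"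
        by (intro mult_right_mono) auto
      also have "\<dots> = f x" using False by (simp add: powr_divide)
      finally show ?thesis .
    qed
    have v0_le: "f v0 * \<bar>x r\<bar> powr p \<le> 2 * f x" if "x \<in> V" "r \<in> P" for x r
    proof -
      have "f v0 * \<bar>x r\<bar> powr p \<le> 2 * (I * \<bar>x r\<bar> powr p)"
        using v0(4) by (simp add: mult_right_mono flip: mult.assoc)
      then show ?thesis using I_le[OF that] by linarith
    qed
    have fv0: "f v0 \<ge> 1" using dom[OF v0(2), of v0] v0(3) by simp
    \<comment> \<open>The lower bound for \<open>f\<close>, taken at \<open>v0\<close> itself, bounds the coordinates of \<open>v0\<close>.\<close>
    have v0_b: "\<bar>v0 r\<bar> \<le> b" if "r \<in> P" for r
    proof -
      have "\<bar>v0 r\<bar> powr p \<le> 2" using v0_le[OF v0(1) that] fv0 by simp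
      then have "(\<bar>v0 r\<bar> powr p) powr (1 / p) \<le> b"
        unfolding b_def using p by (intro powr_mono2) auto
      then show ?thesis using p by (simp add: powr_powr)
    qed
    define P' where "P' = P - {a}"
    have P': "finite P'" "card P' = m" "a \<notin> P'" "P = insert a P'"
      using fin card v0(2) by (auto simp: P'_def)
    have "quasi_power p K P' f" using q by (auto simp: quasi_power_def P'_def)
    from IH[OF P'(1,2) this] obtain v' \<gamma>' where ab: "adapted_basis p C0 f P' v' \<gamma>'" by blast
    have v'0: "v' i r = 0" if "i < m" "r \<notin> P'" for i r
      using ab that P'(2) by (auto simp: adapted_basis_def)
    have v'b: "\<bar>v' i r\<bar> \<le> C0" "\<bar>\<gamma>' i r\<bar> \<le> C0" if "i < m" "r \<in> P'" for i r
      using ab that P'(2) by (auto simp: adapted_basis_def)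
    have fv': "0 < f (v' i)" if "i < m" for i
      using ab that P'(2) by (auto simp: adapted_basis_def)
    have exp': "x r = (\<Sum>i<m. (\<Sum>t\<in>P'. \<gamma>' i t * x t) * v' i r)"
      if "\<And>r. r \<notin> P' \<Longrightarrow> x r = 0" for x r
      using ab that P'(2) unfolding adapted_basis_def by blast
    have bd': "f (v' j) * \<bar>\<Sum>t\<in>P'. \<gamma>' i t * x t\<bar> powr p \<le> C0 * f x"
      if "\<And>r. r \<notin> P' \<Longrightarrow> x r = 0" "i < m" "j \<le> i" for x i j
      using ab that P'(2) unfolding adapted_basis_def by blast
    define v where "v i = (case i of 0 \<Rightarrow> v0 | Suc j \<Rightarrow> v' j)" for i
    define \<gamma> where "\<gamma> i t = (case i of 0 \<Rightarrow> if t = a then 1 else 0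
        | Suc j \<Rightarrow> if t = a then - (\<Sum>s\<in>P'. \<gamma>' j s * v0 s) else \<gamma>' j t)" for i t
    have v_simps: "v 0 = v0" "v (Suc j) = v' j" for j by (auto simp: v_def)
    \<comment> \<open>Elimination of the coordinate \<open>a\<close> with the pivot vector \<open>v0\<close>.\<close>
    define red where "red x = (\<lambda>r. x r - x a * v0 r)" for x :: "'a \<Rightarrow> real"
    have c0: "(\<Sum>t\<in>P. \<gamma> 0 t * x t) = x a" for x
    proof -
      have "(\<Sum>t\<in>P'. \<gamma> 0 t * x t) = 0"
        using P'(3) by (intro sum.neutral) (auto simp: \<gamma>_def)
      then show ?thesis using P' by (simp add: \<gamma>_def)
    qed
    have cS: "(\<Sum>t\<in>P. \<gamma> (Suc i) t * x t) = (\<Sum>t\<in>P'. \<gamma>' i t * red x t)" for i x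
    proof -
      have "(\<Sum>t\<in>P'. \<gamma> (Suc i) t * x t) = (\<Sum>t\<in>P'. \<gamma>' i t * x t)"
        using P'(3) by (intro sum.cong) (auto simp: \<gamma>_def)
      moreover have "\<gamma> (Suc i) a * x a = - (\<Sum>t\<in>P'. \<gamma>' i t * (x a * v0 t))"
        by (simp add: \<gamma>_def sum_distrib_left mult_ac)
      ultimately show ?thesis
        using P' by (simp add: red_def right_diff_distrib sum_subtractf)
    qed
    have red0: "red x r = 0" if "x \<in> V" "r \<notin> P'" for x r
      using that v0 by (auto simp: red_def V_def P'_def)
    have redV: "red x \<in> V" if "x \<in> V" for x using red0[OF that] by (auto simp: V_def P'_def)
    have fred: "f (red x) \<le> 3 * K * f x" if "x \<in> V" for x
    proof -
      have "f (red x) \<le> K * (f x + f (\<lambda>r. (- x a) * v0 r))"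
        using tri[of x "\<lambda>r. (- x a) * v0 r"] by (simp add: red_def)
      also have "f (\<lambda>r. (- x a) * v0 r) = f v0 * \<bar>x a\<bar> powr p" by (subst hom) simp
      also have "\<dots> \<le> 2 * f x" by (rule v0_le[OF that v0(2)])
      finally show ?thesis using K by simp
    qed
    have "adapted_basis p C f P v \<gamma>"
      unfolding adapted_basis_def card
    proof (intro conjI allI impI ballI)
      fix i r assume i: "i < Suc m"
      show "0 < f (v i)"
        using i fv0 fv' by (cases i) (auto simp: v_def)
      show "v i r = 0" if "r \<notin> P"
        using i that v0 v'0 by (cases i) (auto simp: v_def V_def P'_def)
      assume r: "r \<in> P"
      show "\<bar>v i r\<bar> \<le> C"
      proof (cases i)
        case 0 then show ?thesis using v0_b[OF r] C by (simp add: v_def)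
      next
        case (Suc j)
        then show ?thesis using v'b[of j r] v'0[of j r] i r C C0
          by (cases "r \<in> P'") (auto simp: v_def)
      qed
      show "\<bar>\<gamma> i r\<bar> \<le> C"
      proof (cases i)
        case 0 then show ?thesis using C by (simp add: \<gamma>_def)
      next
        case (Suc j)
        have "\<bar>\<Sum>s\<in>P'. \<gamma>' j s * v0 s\<bar> \<le> (\<Sum>s\<in>P'. \<bar>\<gamma>' j s * v0 s\<bar>)" by (rule sum_abs)
        also have "\<dots> \<le> (\<Sum>s\<in>P'. C0 * b)"
          using v'b[of j] v0_b Suc i P' b C0 by (intro sum_mono) (auto simp: abs_mult intro!: mult_mono)
        also have "\<dots> = real m * C0 * b" using P' by simp
        finally show ?thesis using Suc C v'b[of j r] i r P' by (auto simp: \<gamma>_def)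
      qed
    next
      fix x r assume "\<forall>r. r \<notin> P \<longrightarrow> x r = (0::real)"
      then have x: "x \<in> V" by (simp add: V_def)
      have "x r = x a * v0 r + red x r" by (simp add: red_def)
      also have "red x r = (\<Sum>i<m. (\<Sum>t\<in>P'. \<gamma>' i t * red x t) * v' i r)"
        by (intro exp' red0[OF x])
      also have "x a * v0 r + \<dots> = (\<Sum>i<Suc m. (\<Sum>t\<in>P. \<gamma> i t * x t) * v i r)"
        by (simp only: sum.lessThan_Suc_shift c0 cS v_simps)
      finally show "x r = (\<Sum>i<Suc m. (\<Sum>t\<in>P. \<gamma> i t * x t) * v i r)" .
    next
      fix x :: "'a \<Rightarrow> real" and i j assume "\<forall>r. r \<notin> P \<longrightarrow> x r = (0::real)" and i: "i < Suc m" and j: "j \<le> i"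
      then have x: "x \<in> V" by (simp add: V_def)
      have Cf: "t \<le> C * f x" if "t \<le> s * f x" "s \<le> C" for s t
        using that mult_right_mono[OF that(2) nonneg[of x]] by linarith
      show "f (v j) * \<bar>\<Sum>t\<in>P. \<gamma> i t * x t\<bar> powr p \<le> C * f x"
      proof (cases i)
        case 0
        then show ?thesis using j v0_le[OF x v0(2)] C Cf[of _ 2] by (simp add: c0 v_simps del: mult_le_cancel_right)
      next
        case (Suc i')
        show ?thesis
        proof (cases j)
          case 0
          have "f v0 * \<bar>\<Sum>t\<in>P'. \<gamma>' i' t * red x t\<bar> powr p
              \<le> f v0 * (real m powr p * (\<Sum>t\<in>P'. \<bar>\<gamma>' i' t * red x t\<bar> powr p))"
            using fv0 abs_sum_powr_le[OF P'(1) p, of "\<lambda>t. \<gamma>' i' t * red x t"] P'(2)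
            by (intro mult_left_mono) auto
          also have "\<dots> = real m powr p * (\<Sum>t\<in>P'. f v0 * \<bar>\<gamma>' i' t * red x t\<bar> powr p)"
            by (simp add: sum_distrib_left mult_ac)
          also have "(\<Sum>t\<in>P'. f v0 * \<bar>\<gamma>' i' t * red x t\<bar> powr p) \<le> (\<Sum>t\<in>P'. C0 powr p * (6 * K * f x))"
          proof (rule sum_mono)
            fix t assume t: "t \<in> P'"
            have "f v0 * \<bar>\<gamma>' i' t * red x t\<bar> powr p = \<bar>\<gamma>' i' t\<bar> powr p * (f v0 * \<bar>red x t\<bar> powr p)"
              by (simp add: abs_mult powr_mult mult_ac)
            also have "\<dots> \<le> C0 powr p * (2 * f (red x))"
            proof (rule mult_mono)
              show "\<bar>\<gamma>' i' t\<bar> powr p \<le> C0 powr p"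
                using v'b(2)[of i' t] Suc i t p by (intro powr_mono2) auto
              show "f v0 * \<bar>red x t\<bar> powr p \<le> 2 * f (red x)"
                using v0_le[OF redV[OF x], of t] P' t by auto
            qed (use fv0 in auto)
            also have "\<dots> \<le> C0 powr p * (6 * K * f x)"
              using fred[OF x] by (intro mult_left_mono) auto
            finally show "f v0 * \<bar>\<gamma>' i' t * red x t\<bar> powr p \<le> C0 powr p * (6 * K * f x)" .
          qed
          also have "real m powr p * (\<Sum>t\<in>P'. C0 powr p * (6 * K * f x)) = D * f x"
            using P'(2) by (simp add: D_def mult_ac)
          finally have "f v0 * \<bar>\<Sum>t\<in>P'. \<gamma>' i' t * red x t\<bar> powr p \<le> D * f x"
            by (simp add: mult_left_mono)
          then show ?thesis using C Cf[of _ D] 0 Suc by (simp only: cS v_simps)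
        next
          case (Suc j')
          have "f (v' j') * \<bar>\<Sum>t\<in>P'. \<gamma>' i' t * red x t\<bar> powr p \<le> C0 * f (red x)"
            using i j \<open>i = Suc i'\<close> Suc by (intro bd' red0[OF x]) auto
          also have "\<dots> \<le> C0 * (3 * K * f x)"
            using fred[OF x] C0 by (intro mult_left_mono) auto
          also have "\<dots> = (3 * K * C0) * f x" by simp
          finally show ?thesis using C Cf[of _ "3 * K * C0"] \<open>i = Suc i'\<close> Suc
            by (simp only: cS v_simps)
        qed
      qed
    qed
    then show ?thesis by blast
  qed
  then show ?case using C by (intro exI[of _ C]) auto
qed

section \<open>Sums over words\<close>

definition word_sum :: "('m list \<Rightarrow> real) \<Rightarrow> nat \<Rightarrow> real" where
  "word_sum F n = (\<Sum>w | length w = n. F w)"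

lemma finite_words: "finite {w :: 'm::finite list. length w = n}"
  using finite_lists_length_eq[of "UNIV :: 'm set" n] by simp

lemma card_words: "card {w :: 'm::finite list. length w = n} = CARD('m) ^ n"
  using card_lists_length_eq[of "UNIV :: 'm set" n] by simp

lemma word_sum_add_length:
  "word_sum F (k + n) = word_sum (\<lambda>u. word_sum (\<lambda>v. F (u @ v)) n) (k :: nat)"
  for F :: "'m::finite list \<Rightarrow> real"
proof -
  have "word_sum (\<lambda>u. word_sum (\<lambda>v. F (u @ v)) n) k
      = (\<Sum>(u, v)\<in>{u. length u = k} \<times> {v. length v = n}. F (u @ v))"
    by (simp add: word_sum_def sum.cartesian_product)
  also have "\<dots> = word_sum F (k + n)"
    unfolding word_sum_def
    by (rule sum.reindex_bij_witness[where i = "\<lambda>w. (take k w, drop k w)" and j = "\<lambda>(u, v). u @ v"]) auto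
  finally show ?thesis ..
qed

lemma word_sum_mono: "(\<And>w. length w = n \<Longrightarrow> F w \<le> G w) \<Longrightarrow> word_sum F n \<le> word_sum G n"
  unfolding word_sum_def by (intro sum_mono) auto

lemma word_sum_nonneg: "(\<And>w. length w = n \<Longrightarrow> 0 \<le> F w) \<Longrightarrow> 0 \<le> word_sum F n"
  unfolding word_sum_def by (intro sum_nonneg) auto

lemma words_nonempty: "{w :: 'm list. length w = n} \<noteq> {}"
  using length_replicate[of n undefined] by blast

lemma word_sum_pos:
  fixes F :: "'m::finite list \<Rightarrow> real"
  assumes "\<And>w. 0 < F w" shows "0 < word_sum F n"
  unfolding word_sum_def using assms words_nonempty finite_words by (intro sum_pos) auto

lemma word_sum_cmult: "word_sum (\<lambda>w. c * F w) n = c * word_sum F n"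
  by (simp add: word_sum_def sum_distrib_left)

lemma word_sum_cmult_right: "word_sum (\<lambda>w. F w * c) n = word_sum F n * c"
  by (simp add: word_sum_def sum_distrib_right)

lemma word_sum_add: "word_sum (\<lambda>w. F w + G w) n = word_sum F n + word_sum G n"
  by (simp add: word_sum_def sum.distrib)

lemma word_sum_sum: "word_sum (\<lambda>w. \<Sum>k\<in>K. F k w) n = (\<Sum>k\<in>K. word_sum (F k) n)"
  unfolding word_sum_def by (rule sum.swap)

section \<open>Growth of matrix cocycles\<close>

definition entry_norm :: "nat \<Rightarrow> (nat \<Rightarrow> nat \<Rightarrow> real) \<Rightarrow> real" where
  "entry_norm n M = (\<Sum>i<n. \<Sum>j<n. \<bar>M i j\<bar>)"

definition mat_app :: "nat \<Rightarrow> (nat \<Rightarrow> nat \<Rightarrow> real) \<Rightarrow> (nat \<Rightarrow> real) \<Rightarrow> nat \<Rightarrow> real" where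
  "mat_app n M x i = (if i < n then \<Sum>j<n. M i j * x j else 0)"

text \<open>
  The order of the factors is that of \<open>word_prod\<close>. The empty word need not map to the identity, since
  the exterior power representations used below send the identity to a projection.
\<close>

definition cocycle :: "nat \<Rightarrow> ('m list \<Rightarrow> nat \<Rightarrow> nat \<Rightarrow> real) \<Rightarrow> bool" where
  "cocycle n X \<longleftrightarrow> (\<forall>u v. \<forall>i<n. \<forall>j<n. X (u @ v) i j = (\<Sum>k<n. X v i k * X u k j))"

lemma entry_norm_nonneg: "0 \<le> entry_norm n M"
  by (auto simp: entry_norm_def intro!: sum_nonneg)

lemma entry_norm_mult_le:
  assumes "\<And>i j. i < n \<Longrightarrow> j < n \<Longrightarrow> M i j = (\<Sum>k<n. A i k * B k j)"
  shows "entry_norm n M \<le> entry_norm n A * entry_norm n B"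
proof -
  have "entry_norm n M \<le> (\<Sum>i<n. \<Sum>j<n. \<Sum>k<n. \<bar>A i k\<bar> * \<bar>B k j\<bar>)"
    unfolding entry_norm_def
  proof (intro sum_mono)
    fix i j assume "i \<in> {..<n}" "j \<in> {..<n}"
    then have "M i j = (\<Sum>k<n. A i k * B k j)" using assms by auto
    then show "\<bar>M i j\<bar> \<le> (\<Sum>k<n. \<bar>A i k\<bar> * \<bar>B k j\<bar>)"
      by (simp add: sum_abs flip: abs_mult)
  qed
  also have "\<dots> = (\<Sum>i<n. \<Sum>k<n. \<bar>A i k\<bar> * (\<Sum>j<n. \<bar>B k j\<bar>))"
    unfolding sum_distrib_left by (rule sum.cong[OF refl], rule sum.swap)
  also have "\<dots> \<le> (\<Sum>i<n. \<Sum>k<n. \<bar>A i k\<bar> * entry_norm n B)"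
    unfolding entry_norm_def[of n B]
    by (intro sum_mono mult_left_mono member_le_sum[of _ "{..<n}" "\<lambda>i. \<Sum>j<n. \<bar>B i j\<bar>"])
      (auto intro: sum_nonneg)
  also have "\<dots> = entry_norm n A * entry_norm n B"
    by (simp add: entry_norm_def[of n A] sum_distrib_right)
  finally show ?thesis .
qed

lemma mat_app_abs_le:
  assumes "\<And>j. j < n \<Longrightarrow> \<bar>x j\<bar> \<le> b" "0 \<le> b"
  shows "\<bar>mat_app n M x i\<bar> \<le> b * entry_norm n M"
proof (cases "i < n")
  case True
  have "\<bar>mat_app n M x i\<bar> \<le> (\<Sum>j<n. \<bar>M i j\<bar> * \<bar>x j\<bar>)"
    using True by (simp add: mat_app_def sum_abs flip: abs_mult)
  also have "\<dots> \<le> (\<Sum>j<n. \<bar>M i j\<bar> * b)"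
    using assms by (intro sum_mono mult_left_mono) auto
  also have "\<dots> = b * (\<Sum>j<n. \<bar>M i j\<bar>)" by (simp add: sum_distrib_left mult.commute)
  also have "\<dots> \<le> b * entry_norm n M"
    unfolding entry_norm_def using True assms
    by (intro mult_left_mono member_le_sum[of i _ "\<lambda>i. \<Sum>j<n. \<bar>M i j\<bar>"]) (auto intro: sum_nonneg)
  finally show ?thesis .
qed (use assms entry_norm_nonneg[of n M] in \<open>auto simp: mat_app_def\<close>)

lemma mat_app_cocycle:
  assumes "cocycle n X"
  shows "mat_app n (X (u @ v)) x = mat_app n (X v) (mat_app n (X u) x)"
proof
  fix i
  have "(\<Sum>j<n. X (u @ v) i j * x j) = (\<Sum>k<n. X v i k * (\<Sum>j<n. X u k j * x j))" if "i < n"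
  proof -
    have "(\<Sum>j<n. X (u @ v) i j * x j) = (\<Sum>j<n. \<Sum>k<n. X v i k * X u k j * x j)"
      using assms that by (simp add: cocycle_def sum_distrib_right)
    also have "\<dots> = (\<Sum>k<n. X v i k * (\<Sum>j<n. X u k j * x j))"
      by (subst sum.swap) (simp add: sum_distrib_left mult.assoc)
    finally show ?thesis .
  qed
  then show "mat_app n (X (u @ v)) x i = mat_app n (X v) (mat_app n (X u) x) i"
    by (simp add: mat_app_def)
qed

lemma mat_app_scale: "mat_app n M (\<lambda>r. c * x r) = (\<lambda>i. c * mat_app n M x i)"
  by (auto simp: mat_app_def sum_distrib_left mult_ac)

lemma mat_app_add: "mat_app n M (\<lambda>r. x r + y r) = (\<lambda>i. mat_app n M x i + mat_app n M y i)"
  by (auto simp: mat_app_def sum.distrib distrib_left)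

lemma mat_app_sum:
  "mat_app n M (\<lambda>r. \<Sum>k\<in>K. c k * y k r) = (\<lambda>i. \<Sum>k\<in>K. c k * mat_app n M (y k) i)"
proof
  fix i show "mat_app n M (\<lambda>r. \<Sum>k\<in>K. c k * y k r) i = (\<Sum>k\<in>K. c k * mat_app n M (y k) i)"
  proof (cases "i < n")
    case True
    have "(\<Sum>j<n. M i j * (\<Sum>k\<in>K. c k * y k j)) = (\<Sum>j<n. \<Sum>k\<in>K. c k * (M i j * y k j))"
      by (simp add: sum_distrib_left mult_ac)
    also have "\<dots> = (\<Sum>k\<in>K. c k * (\<Sum>j<n. M i j * y k j))"
      unfolding sum_distrib_left by (rule sum.swap)
    finally show ?thesis using True by (simp add: mat_app_def)
  qed (simp add: mat_app_def)
qed

definition power_sum :: "nat \<Rightarrow> real \<Rightarrow> (nat \<Rightarrow> real) \<Rightarrow> real" where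
  "power_sum n p x = (\<Sum>i<n. \<bar>x i\<bar> powr p)"

text \<open>
  The term for \<open>|x|\<^sup>p\<close> makes this function dominate the coordinates even if the empty word acts by a
  proper projection.
\<close>

definition growth :: "nat \<Rightarrow> real \<Rightarrow> ('m list \<Rightarrow> nat \<Rightarrow> nat \<Rightarrow> real) \<Rightarrow> (nat \<Rightarrow> real) \<Rightarrow> real" where
  "growth n p X x = power_sum n p x + (\<Sum>k. word_sum (\<lambda>u. power_sum n p (mat_app n (X u) x)) k)"

lemma power_sum_nonneg: "0 \<le> power_sum n p x"
  by (auto simp: power_sum_def intro!: sum_nonneg)

lemma power_sum_scale: "power_sum n p (\<lambda>r. c * x r) = \<bar>c\<bar> powr p * power_sum n p x"
  by (simp add: power_sum_def abs_mult powr_mult sum_distrib_left)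

lemma power_sum_add:
  "p > 0 \<Longrightarrow> power_sum n p (\<lambda>r. x r + y r) \<le> 2 powr p * (power_sum n p x + power_sum n p y)"
  unfolding power_sum_def sum.distrib[symmetric] sum_distrib_left
  by (intro sum_mono abs_add_powr_le)

lemma summable_growth:
  fixes X :: "'m::finite list \<Rightarrow> nat \<Rightarrow> nat \<Rightarrow> real"
  assumes p: "p > 0" and sm: "summable (word_sum (\<lambda>w. entry_norm n (X w) powr p))"
  shows "summable (word_sum (\<lambda>u. power_sum n p (mat_app n (X u) x)))"
proof -
  define b where "b = (\<Sum>j<n. \<bar>x j\<bar>)"
  have b: "b \<ge> 0" "\<And>j. j < n \<Longrightarrow> \<bar>x j\<bar> \<le> b"
    unfolding b_def by (auto intro!: sum_nonneg member_le_sum[of _ "{..<n}" "\<lambda>j. \<bar>x j\<bar>"])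
  have "power_sum n p (mat_app n (X u) x) \<le> (real n * b powr p) * entry_norm n (X u) powr p" for u
  proof -
    have "power_sum n p (mat_app n (X u) x) \<le> (\<Sum>i<n. (b * entry_norm n (X u)) powr p)"
      unfolding power_sum_def using p by (intro sum_mono powr_mono2 mat_app_abs_le b) auto
    then show ?thesis using b entry_norm_nonneg[of n "X u"] by (simp add: powr_mult)
  qed
  then have "norm (word_sum (\<lambda>u. power_sum n p (mat_app n (X u) x)) k)
     \<le> (real n * b powr p) * word_sum (\<lambda>w. entry_norm n (X w) powr p) k" for k
    by (simp add: word_sum_nonneg power_sum_nonneg flip: word_sum_cmult) (intro word_sum_mono)
  then show ?thesis
    by (intro summable_comparison_test'[OF summable_mult[OF sm]]) auto
qed

lemma quasi_power_growth:
  fixes X :: "'m::finite list \<Rightarrow> nat \<Rightarrow> nat \<Rightarrow> real"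
  assumes p: "p > 0" and sm: "summable (word_sum (\<lambda>w. entry_norm n (X w) powr p))"
  shows "quasi_power p (2 powr p) {..<n} (growth n p X)"
  unfolding quasi_power_def
proof (intro conjI allI ballI)
  note s = summable_growth[OF p sm]
  fix x y :: "nat \<Rightarrow> real" and c :: real and r
  have nn: "0 \<le> (\<Sum>k. word_sum (\<lambda>u. power_sum n p (mat_app n (X u) x)) k)" for x
    by (intro suminf_nonneg s) (auto intro: word_sum_nonneg power_sum_nonneg)
  show "growth n p X (\<lambda>r. c * x r) = \<bar>c\<bar> powr p * growth n p X x"
    unfolding growth_def mat_app_scale power_sum_scale word_sum_cmult suminf_mult[OF s]
    by (simp add: distrib_left)
  show "growth n p X (\<lambda>r. x r + y r) \<le> 2 powr p * (growth n p X x + growth n p X y)"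
  proof -
    have "(\<Sum>k. word_sum (\<lambda>u. power_sum n p (mat_app n (X u) (\<lambda>r. x r + y r))) k)
       \<le> (\<Sum>k. 2 powr p * (word_sum (\<lambda>u. power_sum n p (mat_app n (X u) x)) k
              + word_sum (\<lambda>u. power_sum n p (mat_app n (X u) y)) k))"
      unfolding mat_app_add word_sum_cmult[symmetric] word_sum_add[symmetric]
      by (intro suminf_le word_sum_mono power_sum_add p)
        (use s[of "\<lambda>r. x r + y r"] s[of x] s[of y] in
          \<open>auto simp: mat_app_add word_sum_cmult word_sum_add intro!: summable_mult summable_add\<close>)
    also have "\<dots> = 2 powr p * ((\<Sum>k. word_sum (\<lambda>u. power_sum n p (mat_app n (X u) x)) k)
        + (\<Sum>k. word_sum (\<lambda>u. power_sum n p (mat_app n (X u) y)) k))"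
      by (subst suminf_mult) (auto simp: suminf_add s intro!: summable_add)
    finally show ?thesis
      using power_sum_add[OF p, of n x y] by (simp add: growth_def distrib_left)
  qed
  show "\<bar>x r\<bar> powr p \<le> growth n p X x" if "r \<in> {..<n}"
  proof -
    have "\<bar>x r\<bar> powr p \<le> power_sum n p x"
      unfolding power_sum_def using that by (intro member_le_sum) auto
    then show ?thesis using nn[of x] by (simp add: growth_def)
  qed
  show "0 \<le> growth n p X x" using nn[of x] power_sum_nonneg[of n p x] by (simp add: growth_def)
qed

text \<open>
  Prepending the words \<open>w\<close> of length \<open>N\<close> turns the series over \<open>u\<close> into its own tail starting at
  length \<open>N\<close>; the remaining sum of \<open>|X\<^sub>w x|\<^sup>p\<close> is the \<open>N\<close>-th term of the same series, whence the factor 2.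
\<close>

lemma word_sum_growth_le:
  fixes X :: "'m::finite list \<Rightarrow> nat \<Rightarrow> nat \<Rightarrow> real"
  assumes p: "p > 0" and sm: "summable (word_sum (\<lambda>w. entry_norm n (X w) powr p))"
    and coc: "cocycle n X"
  shows "word_sum (\<lambda>w. growth n p X (mat_app n (X w) x)) N \<le> 2 * growth n p X x"
proof -
  let ?F = "\<lambda>x. word_sum (\<lambda>u. power_sum n p (mat_app n (X u) x))"
  note s = summable_growth[OF p sm]
  have F0: "0 \<le> ?F x k" for k by (auto intro: word_sum_nonneg power_sum_nonneg)
  have "word_sum (\<lambda>w. growth n p X (mat_app n (X w) x)) N
     = ?F x N + word_sum (\<lambda>w. \<Sum>k. ?F (mat_app n (X w) x) k) N"
    by (simp add: growth_def word_sum_add)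
  also have "word_sum (\<lambda>w. \<Sum>k. ?F (mat_app n (X w) x) k) N
     = (\<Sum>k. word_sum (\<lambda>w. ?F (mat_app n (X w) x) k) N)"
    unfolding word_sum_def[of _ N] by (intro suminf_sum[symmetric] s)
  also have "\<dots> = (\<Sum>k. ?F x (k + N))"
    by (subst add.commute) (simp only: word_sum_add_length mat_app_cocycle[OF coc])
  also have "\<dots> \<le> (\<Sum>k. ?F x k)"
    using suminf_split_initial_segment[OF s[of x], of N] sum_nonneg[of "{..<N}" "?F x"] F0 by auto
  also have "?F x N \<le> (\<Sum>k. ?F x k)"
    using sum_le_suminf[OF s[of x], of "{N}"] F0 by auto
  finally show ?thesis using power_sum_nonneg[of n p x] by (simp add: growth_def)
qed

lemma word_sum_entry_norm_mult_le:
  fixes X :: "'m::finite list \<Rightarrow> nat \<Rightarrow> nat \<Rightarrow> real"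
  assumes "cocycle n X" "p > 0"
  defines "Z \<equiv> word_sum (\<lambda>w. entry_norm n (X w) powr p)"
  shows "Z (N * Suc m) \<le> Z N ^ Suc m"
proof (induction m)
  case (Suc m)
  have Z0: "0 \<le> Z k" for k unfolding Z_def by (intro word_sum_nonneg) auto
  have "Z (N * Suc (Suc m)) = Z (N * Suc m + N)" by (simp add: algebra_simps)
  also have "\<dots> \<le> word_sum (\<lambda>u. word_sum (\<lambda>w. entry_norm n (X u) powr p * entry_norm n (X w) powr p) N) (N * Suc m)"
    unfolding Z_def word_sum_add_length
  proof (intro word_sum_mono)
    fix u w :: "'m list"
    have "entry_norm n (X (u @ w)) \<le> entry_norm n (X w) * entry_norm n (X u)"
      using assms(1) by (intro entry_norm_mult_le) (auto simp: cocycle_def)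
    then have "entry_norm n (X (u @ w)) powr p \<le> (entry_norm n (X w) * entry_norm n (X u)) powr p"
      using assms(2) by (intro powr_mono2) (auto simp: entry_norm_nonneg)
    then show "entry_norm n (X (u @ w)) powr p \<le> entry_norm n (X u) powr p * entry_norm n (X w) powr p"
      by (simp add: powr_mult entry_norm_nonneg mult.commute)
  qed
  also have "\<dots> = Z (N * Suc m) * Z N"
    unfolding word_sum_cmult Z_def by (simp add: word_sum_def sum_distrib_right)
  also have "\<dots> \<le> Z N ^ Suc m * Z N"
    by (intro mult_right_mono Suc.IH Z0)
  finally show ?case by (simp add: mult_ac)
qed simp

text \<open>
  Let \<open>a(u)\<close> be the matrix of \<open>X\<^sub>u\<close> in a basis adapted to \<open>f = growth n p X\<close>. For \<open>j \<le> i\<close> the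
  entries \<open>a(w)\<^sub>i\<^sub>j\<close> over words \<open>w\<close> of length \<open>N\<close> have bounded \<open>p\<close>-th power sum, because
  \<open>f(v\<^sub>j) |a(w)\<^sub>i\<^sub>j|\<^sup>p \<le> C f(X\<^sub>w v\<^sub>j)\<close> and the right-hand sides add up to at most \<open>2 C f(v\<^sub>j)\<close>. Induction on the number of
  blocks extends this to the entries \<open>(i, j)\<close> with \<open>j < i + m\<close> of products of \<open>m\<close> blocks, at the price
  of \<open>m - 1\<close> factors \<open>Z\<^sub>N\<close>. For \<open>m = n\<close> these are all entries.
\<close>

lemma word_sum_power_le_of_summable:
  fixes p :: real
  assumes p: "p > 0" and n: "n > 0"
  shows "\<exists>C>0. \<forall>(X :: 'm::finite list \<Rightarrow> nat \<Rightarrow> nat \<Rightarrow> real) N.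
           cocycle n X \<longrightarrow> summable (word_sum (\<lambda>w. entry_norm n (X w) powr p)) \<longrightarrow>
           word_sum (\<lambda>w. entry_norm n (X w) powr p) (N * n)
             \<le> C * word_sum (\<lambda>w. entry_norm n (X w) powr p) N ^ (n - 1)"
proof -
  have "(1::real) \<le> 2 powr p" using p by (intro ge_one_powr_ge_zero) auto
  from ex_adapted_basis[OF p this, where m = n and 'a = nat] obtain C0 where C0: "C0 \<ge> 1"
    and basis: "\<And>f P. finite (P :: nat set) \<Longrightarrow> card P = n \<Longrightarrow> quasi_power p (2 powr p) P f \<Longrightarrow>
           \<exists>v \<gamma>. adapted_basis p C0 f P v \<gamma>" by metis
  define C1 where "C1 = real n * C0 * C0"
  \<comment> \<open>\<open>D m\<close> is the constant for products of \<open>m + 1\<close> blocks; the recursion is read off from the induction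
    step of \<open>Q\<close>.\<close>
  define D where "D m = rec_nat (2 * C0)
      (\<lambda>_ d. real n powr p * (real n * (C1 powr p * (2 * C0 + d)))) m" for m
  have D0: "D 0 = 2 * C0" and
    DS: "D (Suc m) = real n powr p * (real n * (C1 powr p * (2 * C0 + D m)))" for m
    by (simp_all add: D_def)
  have C1: "C1 > 0" unfolding C1_def using C0 n by auto
  have Dpos: "D m > 0" for m
    by (induction m) (use C0 C1 n in \<open>auto simp: D0 DS\<close>)
  define C where "C = (real n * real n * (C0 * C0)) powr p * (real (n * n) powr p * (real (n * n) * D (n - 1)))"
  have "C > 0" unfolding C_def using C0 n Dpos by auto
  moreover have "word_sum (\<lambda>w. entry_norm n (X w) powr p) (N * n)
             \<le> C * word_sum (\<lambda>w. entry_norm n (X w) powr p) N ^ (n - 1)"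
    if coc: "cocycle n X" and sm: "summable (word_sum (\<lambda>w. entry_norm n (X w) powr p))"
    for X :: "'m list \<Rightarrow> nat \<Rightarrow> nat \<Rightarrow> real" and N
  proof -
    define Z where "Z = word_sum (\<lambda>w. entry_norm n (X w) powr p)"
    have Z0: "0 \<le> Z k" for k unfolding Z_def by (intro word_sum_nonneg) auto
    let ?f = "growth n p X"
    from basis[OF _ _ quasi_power_growth[OF p sm]] obtain v \<gamma>
      where ab: "adapted_basis p C0 ?f {..<n} v \<gamma>" by auto
    have v0: "v i r = 0" if "i < n" "\<not> r < n" for i r
      using ab that by (auto simp: adapted_basis_def)
    have vb: "\<bar>v i r\<bar> \<le> C0" "\<bar>\<gamma> i r\<bar> \<le> C0" if "i < n" "r < n" for i r
      using ab that by (auto simp: adapted_basis_def)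
    have fv: "0 < ?f (v i)" if "i < n" for i
      using ab that by (auto simp: adapted_basis_def)
    note ab' = ab[unfolded adapted_basis_def card_lessThan lessThan_iff]
    define c where "c i x = (\<Sum>t<n. \<gamma> i t * x t)" for i and x :: "nat \<Rightarrow> real"
    have exp: "x = (\<lambda>r. \<Sum>i<n. c i x * v i r)" if "\<And>r. \<not> r < n \<Longrightarrow> x r = 0" for x
    proof
      fix r show "x r = (\<Sum>i<n. c i x * v i r)"
        using ab' that unfolding c_def by blast
    qed
    have bd: "?f (v j) * \<bar>c i x\<bar> powr p \<le> C0 * ?f x"
      if "\<And>r. \<not> r < n \<Longrightarrow> x r = 0" "i < n" "j \<le> i" for x i j
      using ab' that unfolding c_def by blast
    have app0: "\<not> r < n \<Longrightarrow> mat_app n M x r = 0" for M x r by (simp add: mat_app_def)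
    define a where "a u i j = c i (mat_app n (X u) (v j))" for u i j
    have c_sum: "c i (\<lambda>r. \<Sum>k\<in>K. t k * y k r) = (\<Sum>k\<in>K. t k * c i (y k))" for i t y and K :: "nat set"
    proof -
      have "c i (\<lambda>r. \<Sum>k\<in>K. t k * y k r) = (\<Sum>r<n. \<Sum>k\<in>K. t k * (\<gamma> i r * y k r))"
        by (simp add: c_def sum_distrib_left mult_ac)
      also have "\<dots> = (\<Sum>k\<in>K. t k * c i (y k))"
        unfolding c_def sum_distrib_left by (rule sum.swap)
      finally show ?thesis .
    qed
    have a_append: "a (u @ w) i j = (\<Sum>k<n. a w i k * a u k j)" for u w i j
    proof -
      have "mat_app n (X u) (v j) = (\<lambda>r. \<Sum>k<n. a u k j * v k r)"
        unfolding a_def by (rule exp) (rule app0)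
      then have "mat_app n (X (u @ w)) (v j) = (\<lambda>r. \<Sum>k<n. a u k j * mat_app n (X w) (v k) r)"
        by (simp add: mat_app_cocycle[OF coc] mat_app_sum)
      then show ?thesis
        by (simp add: a_def[of "u @ w"] c_sum) (simp add: a_def mult.commute)
    qed
    have a_le: "\<bar>a u i j\<bar> \<le> C1 * entry_norm n (X u)" if "i < n" "j < n" for u i j
    proof -
      have "\<bar>a u i j\<bar> \<le> (\<Sum>t<n. \<bar>\<gamma> i t\<bar> * \<bar>mat_app n (X u) (v j) t\<bar>)"
        unfolding a_def c_def by (simp add: sum_abs flip: abs_mult)
      also have "\<dots> \<le> (\<Sum>t<n. C0 * (C0 * entry_norm n (X u)))"
        using that C0 by (intro sum_mono mult_mono mat_app_abs_le vb) auto
      finally show ?thesis by (simp add: C1_def mult_ac)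
    qed
    have a_powr_le: "word_sum (\<lambda>u. \<bar>a u i j\<bar> powr p) k \<le> C1 powr p * Z k" if "i < n" "j < n" for i j k
      unfolding Z_def word_sum_cmult[symmetric]
    proof (intro word_sum_mono)
      fix u
      have "\<bar>a u i j\<bar> powr p \<le> (C1 * entry_norm n (X u)) powr p"
        using p by (intro powr_mono2 a_le that) auto
      then show "\<bar>a u i j\<bar> powr p \<le> C1 powr p * entry_norm n (X u) powr p"
        using C1 by (simp add: powr_mult entry_norm_nonneg)
    qed
    have a_block: "word_sum (\<lambda>w. \<bar>a w i j\<bar> powr p) N \<le> 2 * C0" if "j \<le> i" "i < n" for i j
    proof -
      have "?f (v j) * word_sum (\<lambda>w. \<bar>a w i j\<bar> powr p) N
          \<le> word_sum (\<lambda>w. C0 * ?f (mat_app n (X w) (v j))) N"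
        unfolding word_sum_cmult[symmetric] a_def
        by (intro word_sum_mono bd that app0)
      also have "\<dots> \<le> C0 * (2 * ?f (v j))"
        unfolding word_sum_cmult using C0 by (intro mult_left_mono word_sum_growth_le p sm coc) auto
      finally have "?f (v j) * word_sum (\<lambda>w. \<bar>a w i j\<bar> powr p) N \<le> ?f (v j) * (2 * C0)"
        by (simp add: mult_ac)
      then show ?thesis using fv[of j] that by simp
    qed
    have Q: "word_sum (\<lambda>u. \<bar>a u i j\<bar> powr p) (N * Suc m) \<le> D m * Z N ^ m"
      if "i < n" "j < n" "j \<le> i + m" for m i j
      using that
    proof (induction m arbitrary: i j)
      case 0
      then show ?case using a_block[of j i] by (simp add: D0)
    next
      case (Suc m)
      have "word_sum (\<lambda>u. \<bar>a u i j\<bar> powr p) (N * Suc (Suc m))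
          = word_sum (\<lambda>u. word_sum (\<lambda>w. \<bar>a (u @ w) i j\<bar> powr p) N) (N * Suc m)"
        using word_sum_add_length[of "\<lambda>u. \<bar>a u i j\<bar> powr p" "N * Suc m" N] by (simp add: algebra_simps)
      also have "\<dots> \<le> word_sum (\<lambda>u. word_sum (\<lambda>w.
            real n powr p * (\<Sum>k<n. \<bar>a u k j\<bar> powr p * \<bar>a w i k\<bar> powr p)) N) (N * Suc m)"
      proof (intro word_sum_mono)
        fix u w :: "'m list"
        show "\<bar>a (u @ w) i j\<bar> powr p \<le> real n powr p * (\<Sum>k<n. \<bar>a u k j\<bar> powr p * \<bar>a w i k\<bar> powr p)"
          using abs_sum_powr_le[of "{..<n}" p "\<lambda>k. a w i k * a u k j"] p
          by (simp add: a_append abs_mult powr_mult mult.commute)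
      qed
      also have "\<dots> = real n powr p * (\<Sum>k<n. word_sum (\<lambda>w. \<bar>a w i k\<bar> powr p) N
            * word_sum (\<lambda>u. \<bar>a u k j\<bar> powr p) (N * Suc m))"
        by (simp only: word_sum_cmult word_sum_sum word_sum_cmult_right mult.commute)
      also have "\<dots> \<le> real n powr p * (\<Sum>k<n. C1 powr p * (2 * C0 + D m) * Z N ^ Suc m)"
      proof (intro mult_left_mono sum_mono)
        fix k assume "k \<in> {..<n}"
        then have k: "k < n" by simp
        let ?A = "word_sum (\<lambda>w. \<bar>a w i k\<bar> powr p) N"
        let ?B = "word_sum (\<lambda>u. \<bar>a u k j\<bar> powr p) (N * Suc m)"
        have B0: "0 \<le> ?B" by (intro word_sum_nonneg) auto
        have ZS: "0 \<le> Z N ^ Suc m" using Z0 by simp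
        \<comment> \<open>A path from \<open>i\<close> through \<open>k\<close>: either the new block already uses an entry with \<open>k \<le> i\<close>, or \<open>k > i\<close>
          and the remaining \<open>m + 1\<close> blocks still have to go from \<open>k\<close> to \<open>j \<le> k + m\<close>.\<close>
        show "?A * ?B \<le> C1 powr p * (2 * C0 + D m) * Z N ^ Suc m"
        proof (cases "k \<le> i")
          case True
          have "?B \<le> C1 powr p * Z (N * Suc m)" by (rule a_powr_le[OF k Suc.prems(2)])
          also have "\<dots> \<le> C1 powr p * Z N ^ Suc m"
            unfolding Z_def by (intro mult_left_mono word_sum_entry_norm_mult_le coc p) auto
          finally have "?A * ?B \<le> (2 * C0) * (C1 powr p * Z N ^ Suc m)"
            using a_block[OF True Suc.prems(1)] B0 C0 by (intro mult_mono) auto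
          also have "\<dots> \<le> (2 * C0 + D m) * (C1 powr p * Z N ^ Suc m)"
            using Dpos[of m] Z0 by (intro mult_right_mono) auto
          finally show ?thesis by (simp add: mult_ac)
        next
          case False
          have "?B \<le> D m * Z N ^ m"
            using False Suc.prems k by (intro Suc.IH) auto
          moreover have "?A \<le> C1 powr p * Z N" by (rule a_powr_le[OF Suc.prems(1) k])
          ultimately have "?A * ?B \<le> (C1 powr p * Z N) * (D m * Z N ^ m)"
            using B0 Z0 by (intro mult_mono) auto
          also have "\<dots> = D m * (C1 powr p * Z N ^ Suc m)" by simp
          also have "\<dots> \<le> (2 * C0 + D m) * (C1 powr p * Z N ^ Suc m)"
            using C0 Z0 by (intro mult_right_mono) auto
          finally show ?thesis by (simp add: mult_ac)
        qed
      qed auto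
      also have "\<dots> = D (Suc m) * Z N ^ Suc m" by (simp add: DS)
      finally show ?case .
    qed
    \<comment> \<open>Expanding the unit vectors in the basis \<open>v\<close> bounds the original entries by those of \<open>a u\<close>.\<close>
    have X_le: "entry_norm n (X u) powr p
        \<le> (real n * real n * (C0 * C0)) powr p *
           (real (n * n) powr p * (\<Sum>ij\<in>{..<n} \<times> {..<n}. \<bar>a u (fst ij) (snd ij)\<bar> powr p))" for u
    proof -
      let ?s = "\<Sum>ij\<in>{..<n} \<times> {..<n}. \<bar>a u (fst ij) (snd ij)\<bar>"
      have "\<bar>X u r t\<bar> \<le> C0 * C0 * ?s" if "r < n" "t < n" for r t
      proof -
        define e where "e = (\<lambda>s. if s = t then 1 else 0 :: real)"
        have ce: "c k e = \<gamma> k t" for k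
        proof -
          have "c k e = (\<Sum>s<n. if s = t then \<gamma> k s else 0)"
            unfolding c_def e_def by (intro sum.cong) auto
          then show ?thesis using that by (simp add: sum.delta)
        qed
        have "X u r t = mat_app n (X u) e r"
        proof -
          have "(\<Sum>j<n. X u r j * e j) = (\<Sum>j<n. if j = t then X u r j else 0)"
            unfolding e_def by (intro sum.cong) auto
          then show ?thesis using that by (simp add: sum.delta mat_app_def)
        qed
        also have "e = (\<lambda>r. \<Sum>k<n. \<gamma> k t * v k r)"
          using exp[of e] that by (auto simp: e_def ce[unfolded e_def])
        also have "mat_app n (X u) \<dots> r = (\<Sum>k<n. \<gamma> k t * mat_app n (X u) (v k) r)"
          by (simp add: mat_app_sum)
        also have "\<dots> = (\<Sum>k<n. \<gamma> k t * (\<Sum>i<n. a u i k * v i r))"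
        proof (intro sum.cong refl arg_cong2[of _ _ _ _ "(*)"])
          fix k show "mat_app n (X u) (v k) r = (\<Sum>i<n. a u i k * v i r)"
            unfolding a_def by (rule fun_cong[OF exp[OF app0]])
        qed
        finally have "X u r t = (\<Sum>k<n. \<Sum>i<n. \<gamma> k t * (a u i k * v i r))"
          by (simp add: sum_distrib_left)
        also have "\<dots> = (\<Sum>ij\<in>{..<n} \<times> {..<n}. \<gamma> (snd ij) t * (a u (fst ij) (snd ij) * v (fst ij) r))"
          by (subst sum.swap) (simp add: sum.cartesian_product split_def)
        also have "\<bar>\<dots>\<bar> \<le> (\<Sum>ij\<in>{..<n} \<times> {..<n}. C0 * C0 * \<bar>a u (fst ij) (snd ij)\<bar>)"
        proof (rule order_trans[OF sum_abs], intro sum_mono)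
          fix ij assume "ij \<in> {..<n} \<times> {..<n}"
          then have "\<bar>\<gamma> (snd ij) t\<bar> * \<bar>v (fst ij) r\<bar> \<le> C0 * C0"
            using vb that C0 by (intro mult_mono) auto
          then have "\<bar>\<gamma> (snd ij) t\<bar> * \<bar>v (fst ij) r\<bar> * \<bar>a u (fst ij) (snd ij)\<bar>
              \<le> C0 * C0 * \<bar>a u (fst ij) (snd ij)\<bar>" by (intro mult_right_mono) auto
          then show "\<bar>\<gamma> (snd ij) t * (a u (fst ij) (snd ij) * v (fst ij) r)\<bar>
              \<le> C0 * C0 * \<bar>a u (fst ij) (snd ij)\<bar>" by (simp add: abs_mult mult_ac)
        qed
        finally show ?thesis by (simp add: sum_distrib_left)
      qed
      then have "entry_norm n (X u) \<le> (\<Sum>r<n. \<Sum>t<n. C0 * C0 * ?s)"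
        unfolding entry_norm_def by (intro sum_mono) auto
      also have "\<dots> = real n * real n * (C0 * C0) * ?s" by simp
      finally have "entry_norm n (X u) powr p \<le> (real n * real n * (C0 * C0) * ?s) powr p"
        using p by (intro powr_mono2) (auto simp: entry_norm_nonneg)
      also have "\<dots> = (real n * real n * (C0 * C0)) powr p * ?s powr p"
        by (rule powr_mult)
      also have "?s powr p \<le> real (n * n) powr p * (\<Sum>ij\<in>{..<n} \<times> {..<n}. \<bar>a u (fst ij) (snd ij)\<bar> powr p)"
        using abs_sum_powr_le[of "{..<n} \<times> {..<n}" p "\<lambda>ij. \<bar>a u (fst ij) (snd ij)\<bar>"] p
        by (simp add: abs_of_nonneg sum_nonneg)
      finally show ?thesis by (simp add: mult_left_mono)
    qed
    have "Z (N * n) \<le> (real n * real n * (C0 * C0)) powr p * (real (n * n) powr p *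
        (\<Sum>ij\<in>{..<n} \<times> {..<n}. word_sum (\<lambda>u. \<bar>a u (fst ij) (snd ij)\<bar> powr p) (N * n)))"
      unfolding Z_def word_sum_cmult[symmetric] word_sum_sum[symmetric]
      by (intro word_sum_mono X_le)
    also have "\<dots> \<le> (real n * real n * (C0 * C0)) powr p * (real (n * n) powr p *
        (\<Sum>ij\<in>{..<n} \<times> {..<n}. D (n - 1) * Z N ^ (n - 1)))"
    proof (intro mult_left_mono sum_mono)
      fix ij assume ij: "ij \<in> {..<n} \<times> {..<n}"
      have "word_sum (\<lambda>u. \<bar>a u (fst ij) (snd ij)\<bar> powr p) (N * Suc (n - 1)) \<le> D (n - 1) * Z N ^ (n - 1)"
        using ij by (intro Q) auto
      then show "word_sum (\<lambda>u. \<bar>a u (fst ij) (snd ij)\<bar> powr p) (N * n) \<le> D (n - 1) * Z N ^ (n - 1)"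
        using n by simp
    qed auto
    also have "\<dots> = C * Z N ^ (n - 1)" by (simp add: C_def)
    finally show ?thesis by (simp add: Z_def)
  qed
  ultimately show ?thesis by blast
qed

section \<open>Norms of finite-dimensional representations\<close>

text \<open>
  The sum of the absolute values of the entries in some continuous matrix representation. Natural
  numbers serve as indices so that one predicate covers representations of all dimensions: the
  dimension will grow with the denominator of \<open>s\<close>.
\<close>

definition rep_norm :: "(real^'d^'d \<Rightarrow> real) \<Rightarrow> bool" where
  "rep_norm g \<longleftrightarrow> (\<exists>n R. n > 0 \<and> (\<forall>i j. continuous_on UNIV (\<lambda>B. R B i j)) \<and>
     (\<forall>A B. \<forall>i<n. \<forall>j<n. R (A ** B) i j = (\<Sum>k<n. R A i k * R B k j)) \<and>
     (\<forall>B. g B = entry_norm n (R B)))"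

lemma rep_normE:
  assumes "rep_norm g"
  obtains n R where "n > 0" "\<And>i j. continuous_on UNIV (\<lambda>B. R B i j)"
    "\<And>A B i j. i < n \<Longrightarrow> j < n \<Longrightarrow> R (A ** B) i j = (\<Sum>k<n. R A i k * R B k j)"
    "\<And>B. g B = entry_norm n (R B)"
proof -
  from assms obtain n R where *: "n > 0" "\<forall>i j. continuous_on UNIV (\<lambda>B. R B i j)"
     "\<forall>A B. \<forall>i<n. \<forall>j<n. R (A ** B) i j = (\<Sum>k<n. R A i k * R B k j)"
     "\<forall>B. g B = entry_norm n (R B)" unfolding rep_norm_def by (elim exE conjE)
  show thesis by (rule that[of n R]) (use * in simp_all)
qed

lemma rep_normI:
  fixes R :: "real^'d::finite^'d \<Rightarrow> 'j \<Rightarrow> 'j \<Rightarrow> real"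
  assumes "finite J" "J \<noteq> {}" and cont: "\<And>i j. continuous_on UNIV (\<lambda>B. R B i j)"
    and mult: "\<And>A B i j. i \<in> J \<Longrightarrow> j \<in> J \<Longrightarrow> R (A ** B) i j = (\<Sum>k\<in>J. R A i k * R B k j)"
  shows "rep_norm (\<lambda>B. \<Sum>i\<in>J. \<Sum>j\<in>J. \<bar>R B i j\<bar>)"
proof -
  obtain h where h: "bij_betw h {..<card J} J"
    using ex_bij_betw_nat_finite[OF assms(1)] by (auto simp: atLeast0LessThan)
  have re: "(\<Sum>k\<in>J. f k) = (\<Sum>k<card J. f (h k))" for f :: "'j \<Rightarrow> real"
    by (rule sum.reindex_bij_betw[OF h, symmetric])
  have hJ: "h i \<in> J" if "i < card J" for i using h that by (auto simp: bij_betw_def)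
  show ?thesis
    unfolding rep_norm_def
  proof (intro exI[of _ "card J"] exI[of _ "\<lambda>B i j. R B (h i) (h j)"] conjI allI impI)
    show "card J > 0" using assms by (simp add: card_gt_0_iff)
    show "continuous_on UNIV (\<lambda>B. R B (h i) (h j))" for i j by (rule cont)
    show "R (A ** B) (h i) (h j) = (\<Sum>k<card J. R A (h i) (h k) * R B (h k) (h j))"
      if "i < card J" "j < card J" for A B i j
      using mult[OF hJ[OF that(1)] hJ[OF that(2)]] by (simp add: re)
    show "(\<Sum>i\<in>J. \<Sum>j\<in>J. \<bar>R B i j\<bar>) = entry_norm (card J) (\<lambda>i j. R B (h i) (h j))" for B
      by (simp add: entry_norm_def re)
  qed
qed

lemma rep_norm_one: "rep_norm (\<lambda>_ :: real^'d::finite^'d. 1)"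
  using rep_normI[of "{0::nat}" "\<lambda>_ _ _. 1"] by simp

text \<open>
  The Kronecker product of two representations is a representation, and the entry norm is
  multiplicative under Kronecker products.
\<close>

lemma rep_norm_mult:
  fixes f g :: "real^'d::finite^'d \<Rightarrow> real"
  assumes "rep_norm f" "rep_norm g"
  shows "rep_norm (\<lambda>B. f B * g B)"
proof -
  obtain n R where R: "n > 0" "\<And>i j. continuous_on UNIV (\<lambda>B. R B i j)"
     "\<And>A B i j. i < n \<Longrightarrow> j < n \<Longrightarrow> R (A ** B) i j = (\<Sum>k<n. R A i k * R B k j)"
     "\<And>B. f B = entry_norm n (R B)" by (rule rep_normE[OF assms(1)]) (rule that)
  obtain m S where S: "m > 0" "\<And>i j. continuous_on UNIV (\<lambda>B. S B i j)"
     "\<And>A B i j. i < m \<Longrightarrow> j < m \<Longrightarrow> S (A ** B) i j = (\<Sum>k<m. S A i k * S B k j)"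
     "\<And>B. g B = entry_norm m (S B)" by (rule rep_normE[OF assms(2)]) (rule that)
  let ?J = "{..<n} \<times> {..<m}"
  define T where "T B i j = R B (fst i) (fst j) * S B (snd i) (snd j)" for B i j
  have "rep_norm (\<lambda>B. \<Sum>i\<in>?J. \<Sum>j\<in>?J. \<bar>T B i j\<bar>)"
  proof (rule rep_normI)
    show "continuous_on UNIV (\<lambda>B. T B i j)" for i j
      unfolding T_def by (intro continuous_on_mult R S)
    show "T (A ** B) i j = (\<Sum>k\<in>?J. T A i k * T B k j)" if "i \<in> ?J" "j \<in> ?J" for A B i j
    proof -
      have "T (A ** B) i j = (\<Sum>k<n. R A (fst i) k * R B k (fst j)) * (\<Sum>l<m. S A (snd i) l * S B l (snd j))"
        using that by (auto simp: T_def R S)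
      also have "\<dots> = (\<Sum>k\<in>?J. T A i k * T B k j)"
        by (simp add: sum_product sum.cartesian_product T_def split_def mult_ac)
      finally show ?thesis .
    qed
  qed (use R S in auto)
  also have "(\<lambda>B. \<Sum>i\<in>?J. \<Sum>j\<in>?J. \<bar>T B i j\<bar>) = (\<lambda>B. f B * g B)"
  proof
    fix B
    have "f B * g B = (\<Sum>i<n. \<Sum>i'<m. \<Sum>j<n. \<Sum>j'<m. \<bar>R B i j\<bar> * \<bar>S B i' j'\<bar>)"
      by (simp add: R S entry_norm_def sum_product)
    also have "\<dots> = (\<Sum>i\<in>?J. \<Sum>j\<in>?J. \<bar>T B i j\<bar>)"
      by (simp add: sum.cartesian_product' T_def abs_mult)
    finally show "(\<Sum>i\<in>?J. \<Sum>j\<in>?J. \<bar>T B i j\<bar>) = f B * g B" ..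
  qed
  finally show ?thesis .
qed

lemma rep_norm_power: "rep_norm g \<Longrightarrow> rep_norm (\<lambda>B :: real^'d::finite^'d. g B ^ q)"
  by (induction q) (auto simp: rep_norm_one intro: rep_norm_mult)

lemma rep_norm_nonneg: "rep_norm g \<Longrightarrow> 0 \<le> g B"
  by (elim rep_normE) (simp add: entry_norm_nonneg)

lemma rep_norm_mult_le:
  assumes "rep_norm g" shows "g (A ** B) \<le> g A * g B"
  using assms by (elim rep_normE) (simp add: entry_norm_mult_le)

lemma continuous_on_rep_norm:
  assumes "rep_norm g" shows "continuous_on UNIV g"
proof -
  obtain n R where R: "\<And>i j. continuous_on UNIV (\<lambda>B. R B i j)" "\<And>B. g B = entry_norm n (R B)"
    by (rule rep_normE[OF assms]) (rule that)
  have "g = (\<lambda>B. entry_norm n (R B))" using R(2) by auto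
  then show ?thesis by (simp only:) (unfold entry_norm_def, intro continuous_intros R(1))
qed

section \<open>Exterior powers\<close>

text \<open>
  All index tuples are admitted, not only increasing ones; products of sums then expand directly into
  sums over tuples, and the multiplicity \<open>k!\<close> is compensated by the factor \<open>1 / fact k\<close> in \<open>ext_entry\<close>.
\<close>

definition tuples :: "nat \<Rightarrow> (nat \<Rightarrow> 'd) set" where
  "tuples k = PiE {..<k} (\<lambda>_. UNIV)"

text \<open>
  A \<open>k \<times> k\<close> minor of \<open>B\<close> divided by \<open>k!\<close>; equivalently, an entry of \<open>B\<^sup>\<otimes>\<^sup>k\<close> composed with the projection
  onto antisymmetric tensors.
\<close>

definition ext_entry :: "nat \<Rightarrow> real^'d^'d \<Rightarrow> (nat \<Rightarrow> 'd) \<Rightarrow> (nat \<Rightarrow> 'd) \<Rightarrow> real" where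
  "ext_entry k B I J =
     (\<Sum>\<sigma> | \<sigma> permutes {..<k}. of_int (sign \<sigma>) * (\<Prod>r<k. B $ I r $ J (\<sigma> r))) / fact k"

definition ext_norm :: "nat \<Rightarrow> real^'d^'d \<Rightarrow> real" where
  "ext_norm k B = (\<Sum>I\<in>tuples k. \<Sum>J\<in>tuples k. \<bar>ext_entry k B I J\<bar>)"

lemma finite_tuples: "finite (tuples k :: (nat \<Rightarrow> 'd::finite) set)"
  unfolding tuples_def by (intro finite_PiE) auto

lemma card_tuples: "card (tuples k :: (nat \<Rightarrow> 'd::finite) set) = CARD('d) ^ k"
  unfolding tuples_def by (simp add: card_PiE)

lemma tuples_compose_permutes:
  assumes "\<sigma> permutes {..<k}" shows "bij_betw (\<lambda>J. J \<circ> \<sigma>) (tuples k) (tuples k)"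
proof (rule bij_betw_byWitness[where f' = "\<lambda>J. J \<circ> inv \<sigma>"])
  have in_t: "J \<circ> \<tau> \<in> tuples k" if "\<tau> permutes {..<k}" "J \<in> tuples k" for J \<tau>
    using that by (auto simp: tuples_def PiE_def extensional_def permutes_not_in)
  show "(\<lambda>J. J \<circ> \<sigma>) ` tuples k \<subseteq> tuples k" using in_t[OF assms] by auto
  show "(\<lambda>J. J \<circ> inv \<sigma>) ` tuples k \<subseteq> tuples k" using in_t[OF permutes_inv[OF assms]] by auto
qed (auto simp: o_assoc[symmetric] permutes_inv_o[OF assms])

text \<open>
  The Cauchy-Binet formula. Permuting the tuple \<open>J\<close> multiplies the second minor by the sign of the
  permutation, so each of the \<open>k!\<close> summands of the first minor contributes the same amount.
\<close>

lemma ext_entry_mult: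
  fixes A B :: "real^'d::finite^'d"
  shows "ext_entry k (A ** B) I K = (\<Sum>J\<in>tuples k. ext_entry k A I J * ext_entry k B J K)"
proof -
  let ?P = "{\<sigma>. \<sigma> permutes {..<k}}"
  let ?s = "\<lambda>\<sigma>. real_of_int (sign \<sigma>)"
  have perm: "permutation \<sigma>" if "\<sigma> permutes {..<k}" for \<sigma>
    using that permutation_permutes finite_lessThan by blast
  define G where "G = (\<Sum>\<tau>\<in>?P. ?s \<tau> * (\<Sum>J\<in>tuples k. \<Prod>r<k. A $ I r $ J r * B $ J r $ K (\<tau> r)))"
  have cancel: "x / f * (y / f) * (f * f) = x * y" if "f \<noteq> 0" for x y f :: real
    using that by simp
  have inner: "(\<Sum>J\<in>tuples k. (\<Prod>r<k. A $ I r $ J (\<sigma> r)) * (\<Sum>\<tau>\<in>?P. ?s \<tau> * (\<Prod>r<k. B $ J r $ K (\<tau> r))))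
      = ?s \<sigma> * G" if \<sigma>: "\<sigma> \<in> ?P" for \<sigma>
  proof -
    have p: "\<sigma> permutes {..<k}" using \<sigma> by simp
    have r1: "(\<Sum>\<tau>\<in>?P. ?s \<tau> * (\<Prod>r<k. B $ J r $ K (\<tau> r)))
        = (\<Sum>\<tau>\<in>?P. ?s (\<tau> \<circ> inv \<sigma>) * (\<Prod>r<k. B $ (J \<circ> \<sigma>) r $ K (\<tau> r)))" for J
    proof -
      have "(\<Sum>\<tau>\<in>?P. ?s \<tau> * (\<Prod>r<k. B $ J r $ K (\<tau> r)))
         = (\<Sum>\<tau>\<in>?P. ?s (\<tau> \<circ> inv \<sigma>) * (\<Prod>r<k. B $ J r $ K ((\<tau> \<circ> inv \<sigma>) r)))"
        by (rule sum_permutations_compose_right[OF permutes_inv[OF p]])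
      moreover have "(\<Prod>r<k. B $ J r $ K ((\<tau> \<circ> inv \<sigma>) r)) = (\<Prod>r<k. B $ (J \<circ> \<sigma>) r $ K (\<tau> r))" for \<tau>
        by (subst prod.permute[OF p]) (simp add: o_def permutes_inverses(2)[OF p])
      ultimately show ?thesis by simp
    qed
    have r2: "?s (\<tau> \<circ> inv \<sigma>) = ?s \<sigma> * ?s \<tau>" if "\<tau> \<in> ?P" for \<tau>
      using that perm[OF p] perm[of \<tau>]
      by (simp add: sign_compose sign_inverse permutation_inverse)
    have *: "(\<Sum>\<tau>\<in>?P. ?s \<tau> * (\<Prod>r<k. B $ J r $ K (\<tau> r)))
        = ?s \<sigma> * (\<Sum>\<tau>\<in>?P. ?s \<tau> * (\<Prod>r<k. B $ (J \<circ> \<sigma>) r $ K (\<tau> r)))" for J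
      unfolding r1[of J] sum_distrib_left
    proof (rule sum.cong[OF refl])
      fix \<tau> assume "\<tau> \<in> ?P"
      then show "?s (\<tau> \<circ> inv \<sigma>) * (\<Prod>r<k. B $ (J \<circ> \<sigma>) r $ K (\<tau> r))
          = ?s \<sigma> * (?s \<tau> * (\<Prod>r<k. B $ (J \<circ> \<sigma>) r $ K (\<tau> r)))"
        by (simp only: r2 mult.assoc)
    qed
    have "(\<Sum>J\<in>tuples k. (\<Prod>r<k. A $ I r $ J (\<sigma> r)) * (\<Sum>\<tau>\<in>?P. ?s \<tau> * (\<Prod>r<k. B $ J r $ K (\<tau> r))))
       = (\<Sum>J\<in>tuples k. (\<lambda>J. (\<Prod>r<k. A $ I r $ J r) * (?s \<sigma> * (\<Sum>\<tau>\<in>?P. ?s \<tau> * (\<Prod>r<k. B $ J r $ K (\<tau> r))))) (J \<circ> \<sigma>))"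
      by (intro sum.cong refl) (simp only: *[symmetric], simp only: o_def)
    also have "\<dots> = (\<Sum>J\<in>tuples k. (\<Prod>r<k. A $ I r $ J r) * (?s \<sigma> * (\<Sum>\<tau>\<in>?P. ?s \<tau> * (\<Prod>r<k. B $ J r $ K (\<tau> r)))))"
      by (rule sum.reindex_bij_betw[OF tuples_compose_permutes[OF p]])
    also have "\<dots> = ?s \<sigma> * (\<Sum>J\<in>tuples k. \<Sum>\<tau>\<in>?P. ?s \<tau> * (\<Prod>r<k. A $ I r $ J r * B $ J r $ K (\<tau> r)))"
      by (simp add: sum_distrib_left prod.distrib mult_ac)
    also have "(\<Sum>J\<in>tuples k. \<Sum>\<tau>\<in>?P. ?s \<tau> * (\<Prod>r<k. A $ I r $ J r * B $ J r $ K (\<tau> r))) = G"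
      unfolding G_def sum_distrib_left by (rule sum.swap)
    finally show ?thesis .
  qed
  have "(\<Sum>J\<in>tuples k. ext_entry k A I J * ext_entry k B J K) * (fact k * fact k)
     = (\<Sum>J\<in>tuples k. (\<Sum>\<sigma>\<in>?P. ?s \<sigma> * (\<Prod>r<k. A $ I r $ J (\<sigma> r))) * (\<Sum>\<tau>\<in>?P. ?s \<tau> * (\<Prod>r<k. B $ J r $ K (\<tau> r))))"
    unfolding sum_distrib_right[of _ _ "fact k * fact k"]
    by (intro sum.cong refl) (simp only: ext_entry_def cancel[OF fact_nonzero])
  also have "\<dots> = (\<Sum>J\<in>tuples k. \<Sum>\<sigma>\<in>?P. ?s \<sigma> * ((\<Prod>r<k. A $ I r $ J (\<sigma> r)) * (\<Sum>\<tau>\<in>?P. ?s \<tau> * (\<Prod>r<k. B $ J r $ K (\<tau> r)))))"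
    by (simp only: sum_distrib_right mult.assoc)
  also have "\<dots> = (\<Sum>\<sigma>\<in>?P. ?s \<sigma> * (\<Sum>J\<in>tuples k. (\<Prod>r<k. A $ I r $ J (\<sigma> r)) * (\<Sum>\<tau>\<in>?P. ?s \<tau> * (\<Prod>r<k. B $ J r $ K (\<tau> r)))))"
    by (subst sum.swap) (simp only: sum_distrib_left)
  also have "\<dots> = (\<Sum>\<sigma>\<in>?P. ?s \<sigma> * (?s \<sigma> * G))"
    by (intro sum.cong refl) (simp only: inner)
  also have "\<dots> = (\<Sum>\<sigma>\<in>?P. G)"
    by (intro sum.cong refl) (simp add: sign_def)
  also have "\<dots> = fact k * G" by (simp add: card_permutations)
  finally have "(\<Sum>J\<in>tuples k. ext_entry k A I J * ext_entry k B J K) = G / fact k"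
    by (simp add: field_simps)
  also have "G = (\<Sum>\<tau>\<in>?P. ?s \<tau> * (\<Prod>r<k. (A ** B) $ I r $ K (\<tau> r)))"
    unfolding G_def tuples_def
    by (simp add: matrix_matrix_mult_def prod_sum_PiE)
  finally show ?thesis by (simp add: ext_entry_def)
qed

lemma rep_norm_ext_norm: "rep_norm (ext_norm k :: real^'d::finite^'d \<Rightarrow> real)"
  unfolding ext_norm_def
proof (rule rep_normI)
  show "tuples k \<noteq> ({} :: (nat \<Rightarrow> 'd) set)" by (simp add: tuples_def PiE_eq_empty_iff)
  show "continuous_on UNIV (\<lambda>B :: real^'d^'d. ext_entry k B I J)" for I J
    unfolding ext_entry_def by (intro continuous_intros) auto
qed (auto simp: finite_tuples ext_entry_mult)

text \<open>
  A minor with a repeated row: composing with the transposition of the two rows changes the sign of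
  the sum over permutations and nothing else.
\<close>

lemma ext_entry_eq_0_if_not_inj:
  assumes "a < k" "b < k" "a \<noteq> b" "I a = I b"
  shows "ext_entry k B I J = 0"
proof -
  let ?P = "{\<sigma>. \<sigma> permutes {..<k}}"
  define \<tau> where "\<tau> = Transposition.transpose a b"
  have \<tau>: "\<tau> permutes {..<k}" unfolding \<tau>_def using assms by (intro permutes_swap_id) auto
  have I\<tau>: "I (\<tau> r) = I r" for r using assms by (simp add: \<tau>_def Transposition.transpose_def)
  let ?S = "\<Sum>\<sigma>\<in>?P. real_of_int (sign \<sigma>) * (\<Prod>r<k. B $ I r $ J (\<sigma> r))"
  have "?S = (\<Sum>\<sigma>\<in>?P. real_of_int (sign (\<sigma> \<circ> \<tau>)) * (\<Prod>r<k. B $ I r $ J ((\<sigma> \<circ> \<tau>) r)))"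
    by (rule sum_permutations_compose_right[OF \<tau>])
  also have "\<dots> = (\<Sum>\<sigma>\<in>?P. - (real_of_int (sign \<sigma>) * (\<Prod>r<k. B $ I r $ J (\<sigma> r))))"
  proof (intro sum.cong refl)
    fix \<sigma> assume "\<sigma> \<in> ?P"
    then have "permutation \<sigma>" using permutation_permutes finite_lessThan by blast
    then have "sign (\<sigma> \<circ> \<tau>) = - sign \<sigma>"
      using assms(3) by (simp add: \<tau>_def sign_compose sign_swap_id permutation_swap_id)
    moreover have "(\<Prod>r<k. B $ I r $ J ((\<sigma> \<circ> \<tau>) r)) = (\<Prod>r<k. B $ I r $ J (\<sigma> r))"
      by (subst (2) prod.permute[OF \<tau>]) (simp add: o_def I\<tau>)
    ultimately show "real_of_int (sign (\<sigma> \<circ> \<tau>)) * (\<Prod>r<k. B $ I r $ J ((\<sigma> \<circ> \<tau>) r))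
        = - (real_of_int (sign \<sigma>) * (\<Prod>r<k. B $ I r $ J (\<sigma> r)))" by simp
  qed
  also have "\<dots> = - ?S" by (rule sum_negf)
  finally show ?thesis by (simp add: ext_entry_def)
qed

lemma abs_ext_entry_le:
  assumes "\<And>\<sigma>. \<sigma> permutes {..<k} \<Longrightarrow> (\<Prod>r<k. \<bar>B $ I r $ J (\<sigma> r)\<bar>) \<le> c"
  shows "\<bar>ext_entry k B I J\<bar> \<le> c"
proof -
  let ?P = "{\<sigma>. \<sigma> permutes {..<k}}"
  have "\<bar>\<Sum>\<sigma>\<in>?P. real_of_int (sign \<sigma>) * (\<Prod>r<k. B $ I r $ J (\<sigma> r))\<bar> \<le> (\<Sum>\<sigma>\<in>?P. c)"
    using assms by (intro order_trans[OF sum_abs] sum_mono) (auto simp: abs_mult sign_def abs_prod)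
  also have "\<dots> = fact k * c" by (simp add: card_permutations)
  finally show ?thesis by (simp add: ext_entry_def abs_divide field_simps)
qed

lemma ext_norm_orthogonal_le:
  fixes U :: "real^'d::finite^'d"
  assumes "orthogonal_matrix U"
  shows "ext_norm k U \<le> real CARD('d) ^ k * real CARD('d) ^ k"
proof -
  have "\<bar>U $ i $ j\<bar> \<le> 1" for i j
  proof -
    have "\<bar>row i U $ j\<bar> \<le> norm (row i U)" by (rule component_le_norm_cart)
    then show ?thesis using assms by (simp add: orthogonal_matrix_orthonormal_rows row_def)
  qed
  then have "\<bar>ext_entry k U I J\<bar> \<le> 1" for I J
    by (intro abs_ext_entry_le prod_le_1) auto
  then have "ext_norm k U \<le> (\<Sum>I\<in>(tuples k :: (nat \<Rightarrow> 'd) set). \<Sum>J\<in>(tuples k :: (nat \<Rightarrow> 'd) set). 1)"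
    unfolding ext_norm_def by (intro sum_mono)
  then show ?thesis by (simp add: card_tuples)
qed

text \<open>
  For a diagonal matrix only entries belonging to distinct rows survive. Each of them is at most the
  product of the \<open>k\<close> largest diagonal values, and the entry at the rows and columns of these values equals
  that product divided by \<open>k!\<close>.
\<close>

lemma ext_norm_diag_bounds:
  fixes \<delta> :: "'d::finite \<Rightarrow> real"
  assumes pos: "\<And>i. 0 < \<delta> i" and e: "bij_betw e {..<CARD('d)} UNIV"
    and dec: "\<And>r s. r \<le> s \<Longrightarrow> s < CARD('d) \<Longrightarrow> \<delta> (e s) \<le> \<delta> (e r)" and k: "k \<le> CARD('d)"
  defines "pp \<equiv> \<Prod>r<k. \<delta> (e r)"
  shows "pp / fact k \<le> ext_norm k (diag_mat \<delta>)"
    "ext_norm k (diag_mat \<delta>) \<le> real CARD('d) ^ k * real CARD('d) ^ k * pp"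
proof -
  have e_inj: "e r = e s \<longleftrightarrow> r = s" if "r < CARD('d)" "s < CARD('d)" for r s
    using e that by (auto simp: bij_betw_def inj_on_def)
  have pp: "pp > 0" unfolding pp_def using pos by (intro prod_pos) auto
  define I where "I = restrict e {..<k}"
  have It: "I \<in> tuples k" by (auto simp: I_def tuples_def)
  have "(\<Sum>\<sigma> | \<sigma> permutes {..<k}. real_of_int (sign \<sigma>) * (\<Prod>r<k. diag_mat \<delta> $ I r $ I (\<sigma> r)))
      = (\<Sum>\<sigma>\<in>{id}. real_of_int (sign \<sigma>) * (\<Prod>r<k. diag_mat \<delta> $ I r $ I (\<sigma> r)))"
  proof (rule sum.mono_neutral_right)
    show "finite {\<sigma>. \<sigma> permutes {..<k}}" by (rule finite_permutations) simp
    show "{id} \<subseteq> {\<sigma>. \<sigma> permutes {..<k}}" by (simp add: permutes_id)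
    show "\<forall>\<sigma>\<in>{\<sigma>. \<sigma> permutes {..<k}} - {id}.
        real_of_int (sign \<sigma>) * (\<Prod>r<k. diag_mat \<delta> $ I r $ I (\<sigma> r)) = 0"
    proof
      fix \<sigma> assume "\<sigma> \<in> {\<sigma>. \<sigma> permutes {..<k}} - {id}"
      then have p: "\<sigma> permutes {..<k}" and "\<sigma> \<noteq> id" by auto
      then obtain r where r: "\<sigma> r \<noteq> r" by fastforce
      with p have "r < k" using permutes_not_in by fastforce
      moreover from this have "\<sigma> r < k" using permutes_in_image[OF p] by simp
      ultimately have "diag_mat \<delta> $ I r $ I (\<sigma> r) = 0"
        using r k e_inj[of r "\<sigma> r"] by (simp add: diag_mat_def I_def)
      then have "(\<Prod>r<k. diag_mat \<delta> $ I r $ I (\<sigma> r)) = 0"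
        using \<open>r < k\<close> by (intro prod_zero) auto
      then show "real_of_int (sign \<sigma>) * (\<Prod>r<k. diag_mat \<delta> $ I r $ I (\<sigma> r)) = 0" by simp
    qed
  qed
  also have "\<dots> = pp" by (simp add: sign_id diag_mat_def I_def pp_def)
  finally have "pp / fact k = \<bar>ext_entry k (diag_mat \<delta>) I I\<bar>"
    using pp by (simp add: ext_entry_def)
  also have "\<dots> \<le> (\<Sum>J\<in>tuples k. \<bar>ext_entry k (diag_mat \<delta>) I J\<bar>)"
    using It by (intro member_le_sum) (auto simp: finite_tuples)
  also have "\<dots> \<le> ext_norm k (diag_mat \<delta>)"
    unfolding ext_norm_def
    using It by (intro member_le_sum[of I _ "\<lambda>I. \<Sum>J\<in>tuples k. \<bar>ext_entry k (diag_mat \<delta>) I J\<bar>"])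
      (auto simp: finite_tuples intro: sum_nonneg)
  finally show "pp / fact k \<le> ext_norm k (diag_mat \<delta>)" .
  have "\<bar>ext_entry k (diag_mat \<delta>) I J\<bar> \<le> pp" for I J
  proof (cases "inj_on I {..<k}")
    case False
    then obtain a b where "a < k" "b < k" "a \<noteq> b" "I a = I b" by (auto simp: inj_on_def)
    then have "ext_entry k (diag_mat \<delta>) I J = 0" by (rule ext_entry_eq_0_if_not_inj)
    then show ?thesis using pp by simp
  next
    case True
    define T where "T = {t \<in> {..<CARD('d)}. e t \<in> I ` {..<k}}"
    have bij: "bij_betw e T (I ` {..<k})"
      using e by (auto simp: bij_betw_def T_def inj_on_def image_iff) (metis UNIV_I imageE lessThan_iff)
    have cT: "card T = k"
      using bij_betw_same_card[OF bij] card_image[OF True] by simp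
    have "(\<Prod>r<k. \<delta> (I r)) = (\<Prod>x\<in>I ` {..<k}. \<delta> x)"
      using prod.reindex[OF True, of \<delta>] by (simp add: o_def)
    also have "\<dots> = (\<Prod>t\<in>T. \<delta> (e t))" by (rule prod.reindex_bij_betw[OF bij, symmetric])
    also have "\<dots> \<le> (\<Prod>t<card T. \<delta> (e t))"
      using dec pos by (intro prod_le_prod_initial_segment[where d = "CARD('d)"]) (auto simp: T_def)
    also have "\<dots> = pp" by (simp add: cT pp_def)
    finally have le: "(\<Prod>r<k. \<delta> (I r)) \<le> pp" .
    show ?thesis
    proof (rule abs_ext_entry_le)
      fix \<sigma>
      have "(\<Prod>r<k. \<bar>diag_mat \<delta> $ I r $ J (\<sigma> r)\<bar>) \<le> (\<Prod>r<k. \<delta> (I r))"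
        using pos by (intro prod_mono) (auto simp: diag_mat_def less_imp_le)
      then show "(\<Prod>r<k. \<bar>diag_mat \<delta> $ I r $ J (\<sigma> r)\<bar>) \<le> pp" using le by linarith
    qed
  qed
  then have "ext_norm k (diag_mat \<delta>) \<le> (\<Sum>I\<in>(tuples k :: (nat \<Rightarrow> 'd) set). \<Sum>J\<in>(tuples k :: (nat \<Rightarrow> 'd) set). pp)"
    unfolding ext_norm_def by (intro sum_mono)
  then show "ext_norm k (diag_mat \<delta>) \<le> real CARD('d) ^ k * real CARD('d) ^ k * pp"
    by (simp add: card_tuples mult_ac)
qed

definition sv_prod :: "nat \<Rightarrow> real^'d^'d \<Rightarrow> real" where
  "sv_prod k B = (\<Prod>r<k. singular_value B (Suc r))"

lemma sv_prod_pos: "invertible B \<Longrightarrow> k \<le> CARD('d) \<Longrightarrow> 0 < sv_prod k B"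
  for B :: "real^'d::finite^'d"
  unfolding sv_prod_def by (intro prod_pos) (auto intro: singular_value_pos)

text \<open>
  Multiplication by orthogonal matrices changes \<open>ext_norm\<close> by a bounded factor only, so the singular
  value decomposition reduces the comparison to diagonal matrices.
\<close>

lemma ext_norm_comparable:
  assumes "k \<le> CARD('d::finite)"
  obtains c C where "0 < c" "0 < C" "\<And>B :: real^'d^'d. invertible B \<Longrightarrow> c * sv_prod k B \<le> ext_norm k B"
    "\<And>B :: real^'d^'d. invertible B \<Longrightarrow> ext_norm k B \<le> C * sv_prod k B"
proof -
  define M where "M = real CARD('d) ^ k * real CARD('d) ^ k"
  have M: "M > 0" by (simp add: M_def)
  have "sv_prod k B \<le> (fact k * M * M) * ext_norm k B \<and> ext_norm k B \<le> (M * M * M) * sv_prod k B"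
    if inv: "invertible B" for B :: "real^'d^'d"
  proof -
    from singular_value_decomposition_sorted[OF inv] obtain U V \<delta> e where
      *: "orthogonal_matrix U" "orthogonal_matrix V" "B = U ** diag_mat \<delta> ** V"
      and pos: "\<And>i. 0 < \<delta> i" and e: "bij_betw e {..<CARD('d)} UNIV"
      and sv: "\<And>r. r < CARD('d) \<Longrightarrow> singular_value B (Suc r) = \<delta> (e r)"
      and dec: "\<And>r s. r \<le> s \<Longrightarrow> s < CARD('d) \<Longrightarrow> \<delta> (e s) \<le> \<delta> (e r)" by metis
    have pp: "(\<Prod>r<k. \<delta> (e r)) = sv_prod k B"
      unfolding sv_prod_def using assms sv by (intro prod.cong) auto
    note diag = ext_norm_diag_bounds[of \<delta> e k, OF pos e dec assms, unfolded pp, folded M_def]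
    have U: "ext_norm k U \<le> M" "ext_norm k V \<le> M" "ext_norm k (transpose U) \<le> M" "ext_norm k (transpose V) \<le> M"
      unfolding M_def using * by (auto intro!: ext_norm_orthogonal_le)
    have nn: "0 \<le> ext_norm k X" for X :: "real^'d^'d" by (rule rep_norm_nonneg[OF rep_norm_ext_norm])
    have three: "ext_norm k (X ** Y ** Z) \<le> M * ext_norm k Y * M"
      if "ext_norm k X \<le> M" "ext_norm k Z \<le> M" for X Y Z :: "real^'d^'d"
    proof -
      have "ext_norm k (X ** Y ** Z) \<le> ext_norm k (X ** Y) * ext_norm k Z"
        by (rule rep_norm_mult_le[OF rep_norm_ext_norm])
      also have "\<dots> \<le> (ext_norm k X * ext_norm k Y) * ext_norm k Z"
        by (intro mult_right_mono rep_norm_mult_le[OF rep_norm_ext_norm] nn)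
      also have "\<dots> \<le> (M * ext_norm k Y) * M"
        using that M by (intro mult_mono mult_nonneg_nonneg nn) (auto simp: nn)
      finally show ?thesis .
    qed
    have "ext_norm k B \<le> M * ext_norm k (diag_mat \<delta>) * M" unfolding *(3) by (rule three[OF U(1,2)])
    also have "\<dots> \<le> M * (M * sv_prod k B) * M"
      using diag(2) M by (intro mult_right_mono mult_left_mono) auto
    finally have 1: "ext_norm k B \<le> (M * M * M) * sv_prod k B" by (simp add: mult_ac)
    have "transpose U ** B ** transpose V = (transpose U ** U) ** diag_mat \<delta> ** (V ** transpose V)"
      by (simp add: *(3) matrix_mul_assoc)
    also have "\<dots> = diag_mat \<delta>" using * by (simp add: orthogonal_matrix_def)
    finally have "ext_norm k (diag_mat \<delta>) \<le> M * ext_norm k B * M" using three[OF U(3,4), of B] by simp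
    then have "sv_prod k B / fact k \<le> M * ext_norm k B * M" using diag(1) by linarith
    then have "sv_prod k B \<le> (fact k * M * M) * ext_norm k B" by (simp add: field_simps)
    with 1 show ?thesis by blast
  qed
  then show thesis using M
    by (intro that[of "1 / (fact k * M * M)" "M * M * M"]) (auto simp: field_simps)
qed

section \<open>A submultiplicative model of the singular value function\<close>

text \<open>
  For \<open>s < d\<close> this is the formula for \<open>\<phi>\<^sup>s\<close> with \<open>\<alpha>\<^sub>1 \<cdots> \<alpha>\<^sub>k\<close> replaced by the norm of the \<open>k\<close>-th exterior power, after writing
  \<open>\<alpha>\<^sub>1 \<cdots> \<alpha>\<^sub>k \<alpha>\<^bsub>k+1\<^esub>\<^sup>t\<close> as \<open>(\<alpha>\<^sub>1 \<cdots> \<alpha>\<^sub>k)\<^bsup>1-t\<^esup> (\<alpha>\<^sub>1 \<cdots> \<alpha>\<^bsub>k+1\<^esub>)\<^sup>t\<close>. It is exactly submultiplicative and visibly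
  continuous, without any analysis of how singular values vary.
\<close>

definition svf_model :: "real \<Rightarrow> real^'d^'d \<Rightarrow> real" where
  "svf_model s B =
     (if s < real CARD('d)
      then let k = nat \<lfloor>s\<rfloor> in
        ext_norm k B powr (1 - (s - real k)) * ext_norm (Suc k) B powr (s - real k)
      else ext_norm CARD('d) B powr (s / real CARD('d)))"

lemma svf_eq_sv_prod:
  fixes B :: "real^'d::finite^'d"
  assumes "invertible B" "0 \<le> s"
  shows "svf s B =
     (if s < real CARD('d)
      then let k = nat \<lfloor>s\<rfloor> in
        sv_prod k B powr (1 - (s - real k)) * sv_prod (Suc k) B powr (s - real k)
      else sv_prod CARD('d) B powr (s / real CARD('d)))"
proof (cases "s < real CARD('d)")
  case True
  define k where "k = nat \<lfloor>s\<rfloor>"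
  have k: "real k \<le> s" "k < CARD('d)" using assms(2) True unfolding k_def by linarith+
  have "(\<Prod>i = 1..k. singular_value B i) = sv_prod k B"
    unfolding sv_prod_def by (rule prod.reindex_bij_witness[where j = "\<lambda>i. i - 1" and i = Suc]) auto
  moreover have "sv_prod k B = sv_prod k B powr (1 - (s - real k)) * sv_prod k B powr (s - real k)"
    using sv_prod_pos[OF assms(1), of k] k by (simp add: powr_add[symmetric])
  moreover have "sv_prod (Suc k) B powr (s - real k)
      = sv_prod k B powr (s - real k) * singular_value B (Suc k) powr (s - real k)"
    by (simp add: sv_prod_def powr_mult)
  ultimately show ?thesis
    using True by (simp add: svf_def Let_def mult.assoc flip: k_def)
next
  case False
  then show ?thesis by (simp add: svf_def abs_det_eq_prod_singular_value[OF assms(1)] sv_prod_def)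
qed

lemma powr_comparable:
  fixes x y c C a :: real
  assumes "c * x \<le> y" "y \<le> C * x" "0 < c" "0 < C" "0 < x" "0 \<le> a"
  shows "c powr a * x powr a \<le> y powr a" "y powr a \<le> C powr a * x powr a"
proof -
  have "0 < y" using assms by (meson less_le_trans mult_pos_pos)
  then show "c powr a * x powr a \<le> y powr a" "y powr a \<le> C powr a * x powr a"
    using assms powr_mono2[of a "c * x" y] powr_mono2[of a y "C * x"] by (auto simp: powr_mult)
qed

lemma svf_model_comparable:
  assumes s: "0 \<le> s"
  obtains c C where "0 < c" "0 < C"
    "\<And>B :: real^'d::finite^'d. invertible B \<Longrightarrow> c * svf s B \<le> svf_model s B"
    "\<And>B :: real^'d^'d. invertible B \<Longrightarrow> svf_model s B \<le> C * svf s B"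
proof (cases "s < real CARD('d)")
  case True
  define k where "k = nat \<lfloor>s\<rfloor>"
  define t where "t = s - real k"
  have k: "k < CARD('d)" "0 \<le> t" "t \<le> 1" using s True unfolding k_def t_def by linarith+
  obtain c C where c: "0 < c" "0 < C" "\<And>B :: real^'d^'d. invertible B \<Longrightarrow> c * sv_prod k B \<le> ext_norm k B"
    "\<And>B :: real^'d^'d. invertible B \<Longrightarrow> ext_norm k B \<le> C * sv_prod k B"
    using k by (rule_tac ext_norm_comparable[of k, where 'd = 'd]) auto
  obtain c' C' where c': "0 < c'" "0 < C'" "\<And>B :: real^'d^'d. invertible B \<Longrightarrow> c' * sv_prod (Suc k) B \<le> ext_norm (Suc k) B"
    "\<And>B :: real^'d^'d. invertible B \<Longrightarrow> ext_norm (Suc k) B \<le> C' * sv_prod (Suc k) B"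
    using k by (rule_tac ext_norm_comparable[of "Suc k", where 'd = 'd]) auto
  show thesis
  proof (rule that[of "c powr (1 - t) * c' powr t" "C powr (1 - t) * C' powr t"])
    fix B :: "real^'d^'d" assume inv: "invertible B"
    have svf: "svf s B = sv_prod k B powr (1 - t) * sv_prod (Suc k) B powr t"
      using True by (simp add: svf_eq_sv_prod[OF inv s] Let_def t_def flip: k_def)
    have model: "svf_model s B = ext_norm k B powr (1 - t) * ext_norm (Suc k) B powr t"
      using True by (simp add: svf_model_def Let_def t_def flip: k_def)
    have p: "0 < sv_prod k B" "0 < sv_prod (Suc k) B" using k by (auto intro!: sv_prod_pos inv)
    note 1 = powr_comparable[OF c(3,4)[OF inv] c(1,2) p(1), of "1 - t"]
    note 2 = powr_comparable[OF c'(3,4)[OF inv] c'(1,2) p(2), of t]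
    show "c powr (1 - t) * c' powr t * svf s B \<le> svf_model s B"
      using mult_mono[OF 1(1) 2(1)] k by (simp add: svf model mult_ac)
    show "svf_model s B \<le> C powr (1 - t) * C' powr t * svf s B"
      using mult_mono[OF 1(2) 2(2)] k by (simp add: svf model mult_ac)
  qed (use c c' in auto)
next
  case False
  let ?d = "CARD('d)" let ?a = "s / real CARD('d)"
  obtain c C where c: "0 < c" "0 < C" "\<And>B :: real^'d^'d. invertible B \<Longrightarrow> c * sv_prod ?d B \<le> ext_norm ?d B"
    "\<And>B :: real^'d^'d. invertible B \<Longrightarrow> ext_norm ?d B \<le> C * sv_prod ?d B"
    by (rule ext_norm_comparable[of ?d, where 'd = 'd]) auto
  show thesis
  proof (rule that[of "c powr ?a" "C powr ?a"])
    fix B :: "real^'d^'d" assume inv: "invertible B"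
    have p: "0 < sv_prod ?d B" by (auto intro!: sv_prod_pos inv)
    note 1 = powr_comparable[OF c(3,4)[OF inv] c(1,2) p, of ?a]
    show "c powr ?a * svf s B \<le> svf_model s B" "svf_model s B \<le> C powr ?a * svf s B"
      using 1 False s by (simp_all add: svf_eq_sv_prod[OF inv s] svf_model_def)
  qed (use c in auto)
qed

lemma svf_model_pos:
  fixes B :: "real^'d::finite^'d"
  assumes "0 \<le> s" "invertible B" shows "0 < svf_model s B"
proof -
  obtain c C where "0 < c" "c * svf s B \<le> svf_model s B"
    using svf_model_comparable[OF assms(1), where 'd = 'd] assms(2) by metis
  then show ?thesis using svf_pos[OF assms(2,1)] by (meson less_le_trans mult_pos_pos)
qed

lemma svf_model_mult_le:
  fixes A B :: "real^'d::finite^'d"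
  assumes "0 \<le> s" shows "svf_model s (A ** B) \<le> svf_model s A * svf_model s B"
proof -
  have *: "ext_norm k (A ** B) powr a \<le> ext_norm k A powr a * ext_norm k B powr a" if "0 \<le> a" for k a
  proof -
    have nn: "0 \<le> ext_norm k X" for X :: "real^'d^'d" by (rule rep_norm_nonneg[OF rep_norm_ext_norm])
    have "ext_norm k (A ** B) powr a \<le> (ext_norm k A * ext_norm k B) powr a"
      by (intro powr_mono2 that nn rep_norm_mult_le[OF rep_norm_ext_norm])
    then show ?thesis by (simp add: powr_mult nn)
  qed
  show ?thesis
  proof (cases "s < real CARD('d)")
    case True
    define k where "k = nat \<lfloor>s\<rfloor>"
    define t where "t = s - real k"
    have t: "0 \<le> t" "t \<le> 1" using assms unfolding k_def t_def by linarith+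
    have model: "svf_model s X = ext_norm k X powr (1 - t) * ext_norm (Suc k) X powr t" for X :: "real^'d^'d"
      using True by (simp add: svf_model_def Let_def t_def flip: k_def)
    have "svf_model s (A ** B) \<le> (ext_norm k A powr (1 - t) * ext_norm k B powr (1 - t)) *
        (ext_norm (Suc k) A powr t * ext_norm (Suc k) B powr t)"
      unfolding model using t by (intro mult_mono *) auto
    then show ?thesis by (simp add: model mult_ac)
  qed (use * assms in \<open>auto simp: svf_model_def\<close>)
qed

text \<open>
  For \<open>s < d\<close>, with \<open>s - k = u / n\<close> and \<open>1 - (s - k) = v / n\<close> the model is the \<open>n\<close>-th root of a product of \<open>v\<close> copies
  of one exterior power norm and \<open>u\<close> copies of the next, which is the norm of a tensor product.
\<close>

lemma svf_model_eq_rep_norm_powr: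
  assumes "0 \<le> s" "s \<in> \<rat>"
  obtains g p where "rep_norm g" "0 < p"
    "\<And>B :: real^'d::finite^'d. invertible B \<Longrightarrow> svf_model s B = g B powr p"
proof -
  obtain m n :: nat where n: "n \<noteq> 0" and sq: "s = real m / real n"
    using Rats_abs_nat_div_natE[OF assms(2)] assms(1) by (metis abs_of_nonneg)
  have ext: "0 \<le> ext_norm k B" for k and B :: "real^'d^'d" by (rule rep_norm_nonneg[OF rep_norm_ext_norm])
  have pw: "(x ^ j) powr a = x powr (real j * a)" if "0 < x" for x a :: real and j
    using that by (simp add: powr_realpow[symmetric] powr_powr)
  have extp: "0 < ext_norm k B" if inv: "invertible B" and kd: "k \<le> CARD('d)" for k and B :: "real^'d^'d"
  proof -
    obtain c where "0 < c" "c * sv_prod k B \<le> ext_norm k B"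
      using ext_norm_comparable[OF kd] inv by metis
    then show ?thesis using sv_prod_pos[OF inv kd] by (meson less_le_trans mult_pos_pos)
  qed
  show thesis
  proof (cases "s < real CARD('d)")
    case True
    define k where "k = nat \<lfloor>s\<rfloor>"
    have k: "real k \<le> s" "s \<le> real k + 1" "k < CARD('d)" using assms True unfolding k_def by linarith+
    have "real (k * n) \<le> real m" "real m \<le> real (k * n + n)"
      using k n unfolding sq by (auto simp: field_simps)
    then have kn: "k * n \<le> m" "m \<le> k * n + n" by (simp_all only: of_nat_le_iff)
    define u where "u = m - k * n"
    define v where "v = k * n + n - m"
    have uv: "s - real k = real u * (1 / real n)" "1 - (s - real k) = real v * (1 / real n)"
      using kn n unfolding u_def v_def sq by (auto simp: of_nat_diff field_simps)
    show thesis
    proof (rule that[of "\<lambda>B. ext_norm k B ^ v * ext_norm (Suc k) B ^ u" "1 / real n"])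
      show "rep_norm (\<lambda>B :: real^'d^'d. ext_norm k B ^ v * ext_norm (Suc k) B ^ u)"
        by (intro rep_norm_mult rep_norm_power rep_norm_ext_norm)
      show "svf_model s B = (ext_norm k B ^ v * ext_norm (Suc k) B ^ u) powr (1 / real n)"
        if "invertible B" for B :: "real^'d^'d"
      proof -
        have "svf_model s B = ext_norm k B powr (1 - (s - real k)) * ext_norm (Suc k) B powr (s - real k)"
          using True by (simp add: svf_model_def Let_def flip: k_def)
        also have "\<dots> = (ext_norm k B ^ v) powr (1 / real n) * (ext_norm (Suc k) B ^ u) powr (1 / real n)"
          unfolding uv(2) unfolding uv(1) using k extp[OF that] by (simp add: pw)
        finally show ?thesis by (simp add: powr_mult)
      qed
    qed (use n in auto)
  next
    case False
    show thesis
    proof (rule that[of "\<lambda>B. ext_norm CARD('d) B ^ m" "1 / (real n * real CARD('d))"])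
      show "rep_norm (\<lambda>B :: real^'d^'d. ext_norm CARD('d) B ^ m)"
        by (intro rep_norm_power rep_norm_ext_norm)
      show "svf_model s B = (ext_norm CARD('d) B ^ m) powr (1 / (real n * real CARD('d)))"
        if "invertible B" for B :: "real^'d^'d"
        using False extp[OF that, of "CARD('d)"] by (simp add: svf_model_def pw sq)
    qed (use n in auto)
  qed
qed

section \<open>Pressure and affinity dimension of a contracting tuple\<close>

text \<open>
  Writing \<open>n = q N + r\<close> with \<open>r < N\<close>, subadditivity gives \<open>a n / n \<le> a N / N + O(1 / n)\<close> for every
  fixed \<open>N\<close>; hence the infimum of \<open>a n / n\<close> is the limit.
\<close>

lemma fekete:
  fixes a :: "nat \<Rightarrow> real"
  assumes sub: "\<And>m n. a (m + n) \<le> a m + a n" and bound: "\<And>n. n \<ge> 1 \<Longrightarrow> K * real n \<le> a n"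
  obtains L where "(\<lambda>n. a n / real n) \<longlonglongrightarrow> L" "\<And>n. n \<ge> 1 \<Longrightarrow> L \<le> a n / real n"
proof -
  define S where "S = (\<lambda>n. a n / real n) ` {1..}"
  define L where "L = Inf S"
  have S_ge: "K \<le> y" if "y \<in> S" for y
    using that bound by (auto simp: S_def field_simps)
  have "S \<noteq> {}" by (auto simp: S_def)
  have L_le: "L \<le> a n / real n" if "n \<ge> 1" for n
    unfolding L_def using that by (intro cInf_lower bdd_belowI[of _ K] S_ge) (auto simp: S_def)
  have mult: "a (q * N + r) \<le> real q * a N + a r" for q N r
  proof (induction q)
    case (Suc q)
    have "a (Suc q * N + r) \<le> a N + a (q * N + r)" using sub[of N "q * N + r"] by (simp add: algebra_simps)
    then show ?case using Suc by (simp add: algebra_simps)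
  qed simp
  have "(\<lambda>n. a n / real n) \<longlonglongrightarrow> L"
  proof (rule LIMSEQ_I)
    fix \<epsilon> :: real assume \<epsilon>: "\<epsilon> > 0"
    have "Inf S < L + \<epsilon> / 2" using \<epsilon> by (simp add: L_def)
    from cInf_lessD[OF \<open>S \<noteq> {}\<close> this] obtain N where N: "N \<ge> 1" "a N / real N < L + \<epsilon> / 2"
      by (auto simp: S_def)
    define b where "b = (\<Sum>r<N. \<bar>a r\<bar>) + \<bar>a N\<bar>"
    have up: "a n \<le> real n * (a N / real N) + b" for n
    proof -
      have nN: "n mod N < N" using N by simp
      have "a n \<le> real (n div N) * a N + a (n mod N)"
        using mult[of "n div N" N "n mod N"] by simp
      moreover have "real n = real (n div N) * real N + real (n mod N)"
        by (metis div_mult_mod_eq of_nat_add of_nat_mult)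
      then have "real (n div N) * a N = real n * (a N / real N) - real (n mod N) / real N * a N"
        using N by (simp add: field_simps)
      moreover have "\<bar>real (n mod N) / real N * a N\<bar> \<le> 1 * \<bar>a N\<bar>"
        unfolding abs_mult using nN by (intro mult_right_mono) auto
      moreover have "\<bar>a (n mod N)\<bar> \<le> (\<Sum>r<N. \<bar>a r\<bar>)"
        using nN by (intro member_le_sum[of _ "{..<N}" "\<lambda>r. \<bar>a r\<bar>"]) auto
      ultimately show ?thesis unfolding b_def by linarith
    qed
    obtain n0 :: nat where n0: "real n0 > 2 * b / \<epsilon>" using reals_Archimedean2 by blast
    have "norm (a n / real n - L) < \<epsilon>" if "n \<ge> Suc n0" for n
    proof -
      have n: "real n > 0" "real n > 2 * b / \<epsilon>" using that n0 by (auto intro: less_le_trans)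
      then have "b / real n < \<epsilon> / 2" using \<epsilon> by (simp add: field_simps)
      moreover have "a n / real n \<le> a N / real N + b / real n"
        using up[of n] n(1) by (simp add: field_simps)
      ultimately have "a n / real n < L + \<epsilon>" using N(2) by linarith
      moreover have "L \<le> a n / real n" using L_le that by simp
      ultimately show ?thesis using \<epsilon> by (simp add: abs_less_iff)
    qed
    then show "\<exists>no. \<forall>n\<ge>no. norm (a n / real n - L) < \<epsilon>" by blast
  qed
  then show thesis using L_le that by blast
qed

lemma word_prod_append: "word_prod A (u @ v) = word_prod A v ** word_prod A u"
  by (induction u) (auto simp: matrix_mul_assoc)

lemma invertible_word_prod:
  fixes A :: "(real^'d::finite^'d)^'m"
  assumes "\<And>i. invertible (A $ i)" shows "invertible (word_prod A w)"
proof (induction w)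
  case Nil
  have "invertible (mat 1 :: real^'d^'d)"
    unfolding invertible_def by (rule exI[of _ "mat 1"]) simp
  then show ?case by simp
qed (use assms in \<open>auto intro: invertible_mult\<close>)

lemma norm_word_prod_bounds:
  fixes A :: "(real^'d::finite^'d)^'m"
  assumes "\<And>i x. l * norm x \<le> norm (A $ i *v x)" "\<And>i x. norm (A $ i *v x) \<le> u * norm x" "0 < l" "0 \<le> u"
  shows "l ^ length w * norm x \<le> norm (word_prod A w *v x) \<and> norm (word_prod A w *v x) \<le> u ^ length w * norm x"
proof (induction w arbitrary: x)
  case (Cons i w)
  have 1: "word_prod A (i # w) *v x = word_prod A w *v (A $ i *v x)"
    by (simp add: matrix_vector_mul_assoc)
  have "l ^ length (i # w) * norm x \<le> l ^ length w * norm (A $ i *v x)"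
    using assms(1)[of x i] assms(3) by (simp add: mult.assoc mult.left_commute[of l] mult_left_mono)
  moreover have "u ^ length w * norm (A $ i *v x) \<le> u ^ length (i # w) * norm x"
    using assms(2)[of i x] assms(4) by (simp add: mult.assoc mult.left_commute[of u] mult_left_mono)
  ultimately show ?case unfolding 1 using Cons.IH[of "A $ i *v x"] by linarith
qed simp

lemma ex_contraction_bounds:
  fixes A :: "(real^'d::finite^'d)^'m::finite"
  assumes "A \<in> contracting_tuples"
  obtains l u where "0 < l" "0 < u" "u < 1" "\<And>i x. l * norm x \<le> norm (A $ i *v x)"
    "\<And>i x. norm (A $ i *v x) \<le> u * norm x"
proof -
  have inv: "invertible (A $ i)" and on: "onorm ((*v) (A $ i)) < 1" for i
    using assms by (auto simp: contracting_tuples_def)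
  have "\<exists>B>0. \<forall>x. B * norm x \<le> norm (A $ i *v x)" for i
  proof -
    have "inj ((*v) (A $ i))" using inv invertible_eq_bij bij_is_inj by blast
    then show ?thesis using linear_inj_bounded_below_pos[of "(*v) (A $ i)"] by (metis matrix_vector_mul_linear)
  qed
  then obtain L where L: "\<And>i. L i > 0" "\<And>i x. L i * norm x \<le> norm (A $ i *v x)" by metis
  define l where "l = Min (range L)"
  define u where "u = Max (insert (1/2) (range (\<lambda>i. onorm ((*v) (A $ i)))))"
  show thesis
  proof
    show "0 < l" unfolding l_def using L by (subst Min_gr_iff) auto
    show "u < 1" unfolding u_def using on by (subst Max_less_iff) auto
    have "1 / 2 \<le> u" unfolding u_def by (intro Max_ge) auto
    then show "0 < u" by simp
    fix i x
    have "l \<le> L i" unfolding l_def by (intro Min_le) auto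
    then show "l * norm x \<le> norm (A $ i *v x)"
      using L(2)[of i x] mult_right_mono[of l "L i" "norm x"] by simp
    have "onorm ((*v) (A $ i)) \<le> u" unfolding u_def by (intro Max_ge) auto
    moreover have "norm (A $ i *v x) \<le> onorm ((*v) (A $ i)) * norm x"
      by (intro onorm matrix_vector_mul_bounded_linear)
    ultimately show "norm (A $ i *v x) \<le> u * norm x"
      using mult_right_mono[of _ u "norm x"] norm_ge_zero by fastforce
  qed
qed

definition model_sum :: "(real^'d^'d)^'m \<Rightarrow> real \<Rightarrow> nat \<Rightarrow> real" where
  "model_sum A s = word_sum (\<lambda>w. svf_model s (word_prod A w))"

definition svf_sum :: "(real^'d^'d)^'m \<Rightarrow> real \<Rightarrow> nat \<Rightarrow> real" where
  "svf_sum A s = word_sum (\<lambda>w. svf s (word_prod A w))"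

context
  fixes A :: "(real^'d::finite^'d)^'m::finite"
  assumes A: "A \<in> contracting_tuples"
begin

lemma invertible_word: "invertible (word_prod A w)"
  using A by (intro invertible_word_prod) (auto simp: contracting_tuples_def)

lemma svf_sum_pos: "0 \<le> s \<Longrightarrow> 0 < svf_sum A s n"
  unfolding svf_sum_def by (intro word_sum_pos svf_pos invertible_word)

lemma model_sum_pos: "0 \<le> s \<Longrightarrow> 0 < model_sum A s n"
  unfolding model_sum_def by (intro word_sum_pos svf_model_pos invertible_word)

lemma model_sum_add_le:
  assumes "0 \<le> s" shows "model_sum A s (m + n) \<le> model_sum A s m * model_sum A s n"
proof -
  have "model_sum A s (m + n)
     \<le> word_sum (\<lambda>u. word_sum (\<lambda>v. svf_model s (word_prod A u) * svf_model s (word_prod A v)) n) m"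
    unfolding model_sum_def word_sum_add_length word_prod_append
    by (intro word_sum_mono) (metis svf_model_mult_le[OF assms] mult.commute)
  also have "\<dots> = model_sum A s m * model_sum A s n"
    unfolding model_sum_def word_sum_cmult word_sum_cmult_right ..
  finally show ?thesis .
qed

lemma svf_word_shift:
  assumes "0 \<le> s" "0 \<le> t" "0 < l" "0 < u"
    "\<And>i x. l * norm x \<le> norm (A $ i *v x)" "\<And>i x. norm (A $ i *v x) \<le> u * norm x"
  shows "(l ^ length w) powr t * svf s (word_prod A w) \<le> svf (s + t) (word_prod A w)"
    "svf (s + t) (word_prod A w) \<le> (u ^ length w) powr t * svf s (word_prod A w)"
proof -
  note b = norm_word_prod_bounds[of l A u w, OF assms(5,6,3) less_imp_le[OF assms(4)]]
  have 1: "0 < l ^ length w" using assms by simp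
  have lo: "norm x = 1 \<Longrightarrow> l ^ length w \<le> norm (word_prod A w *v x)" for x using b[of x] by simp
  have up: "norm x = 1 \<Longrightarrow> norm (word_prod A w *v x) \<le> u ^ length w" for x using b[of x] by simp
  show "(l ^ length w) powr t * svf s (word_prod A w) \<le> svf (s + t) (word_prod A w)"
    "svf (s + t) (word_prod A w) \<le> (u ^ length w) powr t * svf s (word_prod A w)"
    by (rule svf_add_bounds[OF invertible_word assms(1,2) 1 lo up]; assumption)+
qed

lemma svf_sum_shift:
  assumes "0 \<le> s" "0 \<le> t" "0 < l" "0 < u"
    "\<And>i x. l * norm x \<le> norm (A $ i *v x)" "\<And>i x. norm (A $ i *v x) \<le> u * norm x"
  shows "real n * (t * ln l) + ln (svf_sum A s n) \<le> ln (svf_sum A (s + t) n)"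
    "ln (svf_sum A (s + t) n) \<le> real n * (t * ln u) + ln (svf_sum A s n)"
proof -
  have p: "0 < svf_sum A s n" "0 < svf_sum A (s + t) n" using assms by (auto intro: svf_sum_pos)
  have "(l ^ n) powr t * svf_sum A s n \<le> svf_sum A (s + t) n"
    unfolding svf_sum_def word_sum_cmult[symmetric]
    using svf_word_shift(1)[OF assms] by (intro word_sum_mono) auto
  then have "ln ((l ^ n) powr t * svf_sum A s n) \<le> ln (svf_sum A (s + t) n)"
    using p assms by (subst ln_le_cancel_iff) auto
  then show "real n * (t * ln l) + ln (svf_sum A s n) \<le> ln (svf_sum A (s + t) n)"
    using p assms by (simp add: ln_mult ln_powr ln_realpow mult_ac)
  have "svf_sum A (s + t) n \<le> (u ^ n) powr t * svf_sum A s n"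
    unfolding svf_sum_def word_sum_cmult[symmetric]
    using svf_word_shift(2)[OF assms] by (intro word_sum_mono) auto
  then have "ln (svf_sum A (s + t) n) \<le> ln ((u ^ n) powr t * svf_sum A s n)"
    using p assms by (subst ln_le_cancel_iff) auto
  then show "ln (svf_sum A (s + t) n) \<le> real n * (t * ln u) + ln (svf_sum A s n)"
    using p assms by (simp add: ln_mult ln_powr ln_realpow mult_ac)
qed

lemma svf_sum_0: "svf_sum A 0 n = real CARD('m) ^ n"
  by (simp add: svf_sum_def word_sum_def svf_0[OF invertible_word] card_words)

text \<open>
  The comparison constants between \<open>\<phi>\<^sup>s\<close> and its model disappear after division by \<open>n\<close>, so both sums
  have the same growth rate, and Fekete's lemma for the model also bounds this rate from above at every
  finite \<open>n\<close>.
\<close>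

lemma pressure_limits:
  assumes s: "0 \<le> s"
  shows "(\<lambda>n. ln (svf_sum A s n) / real n) \<longlonglongrightarrow> svf_pressure A s"
    "(\<lambda>n. ln (model_sum A s n) / real n) \<longlonglongrightarrow> svf_pressure A s"
    "n \<ge> 1 \<Longrightarrow> svf_pressure A s \<le> ln (model_sum A s n) / real n"
proof -
  obtain l u where lu: "0 < l" "0 < u" "u < 1" "\<And>i x. l * norm x \<le> norm (A $ i *v x)"
    "\<And>i x. norm (A $ i *v x) \<le> u * norm x" by (rule ex_contraction_bounds[OF A]) (rule that)
  obtain c C where c: "0 < c" "0 < C"
    "\<And>B :: real^'d^'d. invertible B \<Longrightarrow> c * svf s B \<le> svf_model s B"
    "\<And>B :: real^'d^'d. invertible B \<Longrightarrow> svf_model s B \<le> C * svf s B"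
    by (rule svf_model_comparable[OF s, where 'd = 'd]) (rule that)
  have p: "0 < svf_sum A s n" "0 < model_sum A s n" for n
    using s by (auto intro: svf_sum_pos model_sum_pos)
  have cmp: "ln c + ln (svf_sum A s n) \<le> ln (model_sum A s n)" "ln (model_sum A s n) \<le> ln C + ln (svf_sum A s n)" for n
  proof -
    have "c * svf_sum A s n \<le> model_sum A s n" "model_sum A s n \<le> C * svf_sum A s n"
      unfolding svf_sum_def model_sum_def word_sum_cmult[symmetric]
      by (intro word_sum_mono c invertible_word)+
    then have "ln (c * svf_sum A s n) \<le> ln (model_sum A s n)" "ln (model_sum A s n) \<le> ln (C * svf_sum A s n)"
      using p c by (auto intro!: ln_mono)
    then show "ln c + ln (svf_sum A s n) \<le> ln (model_sum A s n)" "ln (model_sum A s n) \<le> ln C + ln (svf_sum A s n)"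
      using p[of n] c by (auto simp: ln_mult)
  qed
  define K where "K = s * ln l - \<bar>ln c\<bar>"
  have "K * real n \<le> ln (model_sum A s n)" if "n \<ge> 1" for n
  proof -
    have "real n * (s * ln l) + ln (svf_sum A 0 n) \<le> ln (svf_sum A s n)"
      using svf_sum_shift(1)[of 0 s l u n] s lu by simp
    moreover have "0 \<le> ln (svf_sum A 0 n)" by (simp add: svf_sum_0)
    moreover have "\<bar>ln c\<bar> \<le> real n * \<bar>ln c\<bar>" using that mult_right_mono[of 1 "real n" "\<bar>ln c\<bar>"] by simp
    ultimately show ?thesis using cmp(1)[of n] by (simp add: K_def algebra_simps)
  qed
  moreover have "ln (model_sum A s (m + n)) \<le> ln (model_sum A s m) + ln (model_sum A s n)" for m n
    using ln_mono[OF model_sum_add_le[OF s, of m n] p(2)] p(2)[of m] p(2)[of n] by (simp add: ln_mult)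
  ultimately obtain L where L: "(\<lambda>n. ln (model_sum A s n) / real n) \<longlonglongrightarrow> L"
    "\<And>n. n \<ge> 1 \<Longrightarrow> L \<le> ln (model_sum A s n) / real n"
    using fekete[of "\<lambda>n. ln (model_sum A s n)" K] by metis
  have lim: "(\<lambda>n. ln (svf_sum A s n) / real n) \<longlonglongrightarrow> L"
  proof (rule tendsto_sandwich)
    show "(\<lambda>n. ln (model_sum A s n) / real n - ln C / real n) \<longlonglongrightarrow> L"
      using tendsto_diff[OF L(1) tendsto_divide_0[OF tendsto_const filterlim_real_at_infinity_sequentially]] by simp
    show "(\<lambda>n. ln (model_sum A s n) / real n - ln c / real n) \<longlonglongrightarrow> L"
      using tendsto_diff[OF L(1) tendsto_divide_0[OF tendsto_const filterlim_real_at_infinity_sequentially]] by simp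
    show "\<forall>\<^sub>F n in sequentially. ln (model_sum A s n) / real n - ln C / real n \<le> ln (svf_sum A s n) / real n"
      unfolding diff_divide_distrib[symmetric] using cmp(2)
      by (intro always_eventually allI divide_right_mono) (auto simp: diff_le_eq add.commute)
    show "\<forall>\<^sub>F n in sequentially. ln (svf_sum A s n) / real n \<le> ln (model_sum A s n) / real n - ln c / real n"
      unfolding diff_divide_distrib[symmetric] using cmp(1)
      by (intro always_eventually allI divide_right_mono) (auto simp: le_diff_eq add.commute)
  qed
  have "svf_pressure A s = L"
    unfolding svf_pressure_def using lim
    by (intro limI) (simp add: svf_sum_def word_sum_def)
  with L lim show "(\<lambda>n. ln (svf_sum A s n) / real n) \<longlonglongrightarrow> svf_pressure A s"
    "(\<lambda>n. ln (model_sum A s n) / real n) \<longlonglongrightarrow> svf_pressure A s"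
    "n \<ge> 1 \<Longrightarrow> svf_pressure A s \<le> ln (model_sum A s n) / real n" by auto
qed

lemma svf_pressure_0: "svf_pressure A 0 = ln (real CARD('m))"
proof (rule LIMSEQ_unique[OF pressure_limits(1)])
  have "\<forall>\<^sub>F n in sequentially. ln (svf_sum A 0 n) / real n = ln (real CARD('m))"
    using eventually_gt_at_top[of 0] by eventually_elim (simp add: svf_sum_0 ln_realpow)
  then show "(\<lambda>n. ln (svf_sum A 0 n) / real n) \<longlonglongrightarrow> ln (real CARD('m))" by (rule tendsto_eventually)
qed simp

lemma svf_pressure_shift:
  assumes "0 \<le> s" "0 \<le> t" "0 < l" "0 < u"
    "\<And>i x. l * norm x \<le> norm (A $ i *v x)" "\<And>i x. norm (A $ i *v x) \<le> u * norm x"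
  shows "t * ln l + svf_pressure A s \<le> svf_pressure A (s + t)"
    "svf_pressure A (s + t) \<le> t * ln u + svf_pressure A s"
proof -
  have st: "0 \<le> s + t" using assms by simp
  have lims: "(\<lambda>n. c + ln (svf_sum A s n) / real n) \<longlonglongrightarrow> c + svf_pressure A s" for c
    by (intro tendsto_intros pressure_limits assms)
  show "t * ln l + svf_pressure A s \<le> svf_pressure A (s + t)"
  proof (rule LIMSEQ_le[OF lims pressure_limits(1)[OF st]], intro exI[of _ 1] allI impI)
    fix n :: nat assume "1 \<le> n"
    then show "t * ln l + ln (svf_sum A s n) / real n \<le> ln (svf_sum A (s + t) n) / real n"
      using divide_right_mono[OF svf_sum_shift(1)[OF assms, of n], of "real n"]
      by (simp add: add_divide_distrib)
  qed
  show "svf_pressure A (s + t) \<le> t * ln u + svf_pressure A s"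
  proof (rule LIMSEQ_le[OF pressure_limits(1)[OF st] lims], intro exI[of _ 1] allI impI)
    fix n :: nat assume "1 \<le> n"
    then show "ln (svf_sum A (s + t) n) / real n \<le> t * ln u + ln (svf_sum A s n) / real n"
      using divide_right_mono[OF svf_sum_shift(2)[OF assms, of n], of "real n"]
      by (simp add: add_divide_distrib)
  qed
qed

lemma svf_pressure_strict_decreasing:
  assumes "0 \<le> s" "s < t" shows "svf_pressure A t < svf_pressure A s"
proof -
  obtain l u where lu: "0 < l" "0 < u" "u < 1" "\<And>i x. l * norm x \<le> norm (A $ i *v x)"
    "\<And>i x. norm (A $ i *v x) \<le> u * norm x" by (rule ex_contraction_bounds[OF A]) (rule that)
  have "svf_pressure A t \<le> (t - s) * ln u + svf_pressure A s"
    using svf_pressure_shift(2)[of s "t - s" l u] lu assms by simp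
  moreover have "(t - s) * ln u < 0" using lu assms by (intro mult_pos_neg) auto
  ultimately show ?thesis by linarith
qed

text \<open>
  The pressure is positive at 0, decays at least linearly and is Lipschitz, so the intermediate value
  theorem gives a zero; strict monotonicity makes it unique.
\<close>

lemma affinity_dimension_zero:
  assumes m: "CARD('m) \<ge> 2"
  shows "0 < affinity_dimension A" "svf_pressure A (affinity_dimension A) = 0"
proof -
  obtain l u where lu: "0 < l" "0 < u" "u < 1" "\<And>i x. l * norm x \<le> norm (A $ i *v x)"
    "\<And>i x. norm (A $ i *v x) \<le> u * norm x" by (rule ex_contraction_bounds[OF A]) (rule that)
  let ?P = "svf_pressure A"
  have P0: "?P 0 > 0" using m by (simp add: svf_pressure_0)
  define b where "b = ?P 0 / (- ln u)"
  have lnu: "ln u < 0" using lu by simp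
  have b: "b > 0" unfolding b_def using P0 lnu by (intro divide_pos_pos) auto
  have "?P b \<le> b * ln u + ?P 0" using svf_pressure_shift(2)[of 0 b l u] lu b by simp
  also have "b * ln u = - ?P 0" using lnu by (simp add: b_def)
  finally have Pb: "?P b \<le> 0" by simp
  have lip: "\<bar>?P y - ?P x\<bar> \<le> (\<bar>ln l\<bar> + \<bar>ln u\<bar>) * \<bar>y - x\<bar>" if "0 \<le> x" "x \<le> y" for x y
  proof -
    have 1: "(y - x) * ln l \<le> ?P y - ?P x" "?P y - ?P x \<le> (y - x) * ln u"
      using svf_pressure_shift[of x "y - x" l u] lu that by auto
    have 2: "- ((y - x) * \<bar>ln l\<bar>) \<le> (y - x) * ln l" "(y - x) * ln u \<le> (y - x) * \<bar>ln u\<bar>"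
      using that mult_left_mono[of "- \<bar>ln l\<bar>" "ln l" "y - x"] mult_left_mono[of "ln u" "\<bar>ln u\<bar>" "y - x"] by auto
    have 3: "0 \<le> (y - x) * \<bar>ln l\<bar>" "0 \<le> (y - x) * \<bar>ln u\<bar>" using that by auto
    have 4: "(\<bar>ln l\<bar> + \<bar>ln u\<bar>) * \<bar>y - x\<bar> = (y - x) * \<bar>ln l\<bar> + (y - x) * \<bar>ln u\<bar>"
      using that by (simp add: algebra_simps)
    show ?thesis unfolding 4 abs_le_iff using 1 2 3 by linarith
  qed
  have "(\<bar>ln l\<bar> + \<bar>ln u\<bar>)-lipschitz_on {0..b} ?P"
  proof (rule lipschitz_onI)
    fix x y assume "x \<in> {0..b}" "y \<in> {0..b}"
    then show "dist (?P x) (?P y) \<le> (\<bar>ln l\<bar> + \<bar>ln u\<bar>) * dist x y"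
      using lip[of x y] lip[of y x] by (cases "x \<le> y") (auto simp: dist_real_def abs_minus_commute)
  qed auto
  then have "continuous_on {0..b} ?P" by (rule lipschitz_on_continuous_on)
  then obtain x where x: "0 \<le> x" "x \<le> b" "?P x = 0"
    using IVT2'[of ?P b 0 0] Pb P0 b by (auto simp: less_imp_le)
  then have x0: "0 < x" using P0 by (cases "x = 0") auto
  have "\<exists>!s. 0 < s \<and> ?P s = 0"
  proof (rule ex1I[of _ x])
    fix s assume "0 < s \<and> ?P s = 0"
    then show "s = x"
      using svf_pressure_strict_decreasing[of s x] svf_pressure_strict_decreasing[of x s] x x0
      by (cases s x rule: linorder_cases) auto
  qed (use x x0 in auto)
  from theI'[OF this] show "0 < affinity_dimension A" "?P (affinity_dimension A) = 0"
    unfolding affinity_dimension_def by auto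
qed

lemma affinity_dimension_less_iff:
  assumes m: "CARD('m) \<ge> 2" and s: "0 \<le> s"
  shows "svf_pressure A s < 0 \<longleftrightarrow> affinity_dimension A < s" "0 < svf_pressure A s \<longleftrightarrow> s < affinity_dimension A"
proof -
  note z = affinity_dimension_zero[OF m]
  show "svf_pressure A s < 0 \<longleftrightarrow> affinity_dimension A < s" "0 < svf_pressure A s \<longleftrightarrow> s < affinity_dimension A"
    using svf_pressure_strict_decreasing[of s "affinity_dimension A"]
      svf_pressure_strict_decreasing[of "affinity_dimension A" s] z s
    by (cases s "affinity_dimension A" rule: linorder_cases; auto)+
qed

end

section \<open>Continuity\<close>

lemma continuous_on_matrix_mult:
  fixes f g :: "'a::topological_space \<Rightarrow> real^'d::finite^'d"
  assumes "continuous_on S f" "continuous_on S g"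
  shows "continuous_on S (\<lambda>x. f x ** g x)"
  unfolding matrix_matrix_mult_def by (intro continuous_intros assms)

lemma continuous_on_word_prod: "continuous_on S (\<lambda>A :: (real^'d::finite^'d)^'m::finite. word_prod A w)"
  by (induction w) (auto intro!: continuous_on_matrix_mult continuous_intros)

lemma continuous_on_model_sum:
  assumes "0 \<le> s" "s \<in> \<rat>"
  shows "continuous_on contracting_tuples (\<lambda>A :: (real^'d::finite^'d)^'m::finite. model_sum A s n)"
proof -
  obtain g p where g: "rep_norm g" "0 < p"
    "\<And>B :: real^'d^'d. invertible B \<Longrightarrow> svf_model s B = g B powr p"
    by (rule svf_model_eq_rep_norm_powr[OF assms, where 'd = 'd]) (rule that)
  have "continuous_on contracting_tuples (\<lambda>A :: (real^'d^'d)^'m. word_sum (\<lambda>w. g (word_prod A w) powr p) n)"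
    unfolding word_sum_def
  proof (intro continuous_on_sum continuous_on_powr continuous_on_const ballI)
    show "continuous_on contracting_tuples (\<lambda>A :: (real^'d^'d)^'m. g (word_prod A w))" for w
      using continuous_on_rep_norm[OF g(1)] continuous_on_word_prod
      by (rule continuous_on_compose2) auto
    show "g (word_prod A w) \<noteq> 0" if "A \<in> contracting_tuples" for w and A :: "(real^'d^'d)^'m"
      using svf_model_pos[OF assms(1) invertible_word[OF that, of w]] g(3)[OF invertible_word[OF that, of w]] by auto
  qed
  then show ?thesis
    by (rule continuous_on_eq) (auto simp: model_sum_def word_sum_def g(3) invertible_word)
qed

lemma summable_model_sum_of_negative_pressure:
  fixes A :: "(real^'d::finite^'d)^'m::finite"
  assumes A: "A \<in> contracting_tuples" and s: "0 \<le> s" and neg: "svf_pressure A s < 0"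
  shows "summable (model_sum A s)"
proof -
  let ?e = "svf_pressure A s / 2"
  have "\<forall>\<^sub>F n in sequentially. ln (model_sum A s n) / real n < ?e"
    using pressure_limits(2)[OF A s] neg by (intro order_tendstoD(2)) auto
  then have "\<forall>\<^sub>F n in sequentially. norm (model_sum A s n) \<le> exp ?e ^ n"
    using eventually_gt_at_top[of 0]
  proof eventually_elim
    case (elim n)
    have p: "0 < model_sum A s n" using A s by (rule model_sum_pos)
    have "ln (model_sum A s n) \<le> real n * ?e" using elim by (simp add: field_simps)
    then have "model_sum A s n \<le> exp ?e ^ n"
      using p by (metis exp_le_cancel_iff exp_ln exp_of_nat_mult)
    then show ?case using p by simp
  qed
  moreover have "summable (\<lambda>n. exp ?e ^ n)" using neg by (intro summable_geometric) simp
  ultimately show ?thesis by (rule summable_comparison_test_ev)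
qed

text \<open>
  On a logarithmic scale, and after division by \<open>N\<close>, the left side tends to \<open>(n - 1) P\<close> whereas the
  right side is at least \<open>n P\<close> by the infimum property of the pressure.
\<close>

lemma ex_model_sum_power_less:
  fixes A :: "(real^'d::finite^'d)^'m::finite"
  assumes A: "A \<in> contracting_tuples" and s: "0 \<le> s" and pos: "0 < svf_pressure A s"
    and n: "n > 0" and C: "C > 0"
  shows "\<exists>N. C * model_sum A s N ^ (n - 1) < model_sum A s (N * n)"
proof -
  let ?P = "svf_pressure A s"
  have "(\<lambda>N. real (n - 1) * (ln (model_sum A s N) / real N) + ln C / real N)
      \<longlonglongrightarrow> real (n - 1) * ?P + 0"
    by (intro tendsto_intros pressure_limits(2)[OF A s]
        tendsto_divide_0[OF tendsto_const filterlim_real_at_infinity_sequentially])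
  moreover have "real (n - 1) * ?P + 0 < real n * ?P" using n pos by simp
  ultimately have "\<forall>\<^sub>F N in sequentially.
      real (n - 1) * (ln (model_sum A s N) / real N) + ln C / real N < real n * ?P"
    by (rule order_tendstoD(2))
  then have "\<forall>\<^sub>F N in sequentially. 0 < N \<and>
      real (n - 1) * (ln (model_sum A s N) / real N) + ln C / real N < real n * ?P"
    using eventually_gt_at_top[of 0] by eventually_elim auto
  then obtain N where N: "N > 0"
    "real (n - 1) * (ln (model_sum A s N) / real N) + ln C / real N < real n * ?P"
    by (auto dest: eventually_happens)
  have p: "0 < model_sum A s k" for k using A s by (rule model_sum_pos)
  have "ln (C * model_sum A s N ^ (n - 1)) = real (n - 1) * ln (model_sum A s N) + ln C"
    using p[of N] C by (simp add: ln_mult ln_realpow)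
  also have "\<dots> < real (N * n) * ?P" using N by (simp add: field_simps)
  also have "\<dots> \<le> ln (model_sum A s (N * n))"
    using pressure_limits(3)[OF A s, of "N * n"] N n by (simp add: field_simps)
  finally show ?thesis using p C by (intro exI[of _ N]) (simp add: ln_less_cancel_iff)
qed

text \<open>
  The numbers \<open>n\<close> and \<open>C\<close> are chosen before the tuple \<open>A\<close>, so the bound can be compared with its
  failure at a nearby tuple.
\<close>

lemma ex_model_sum_power_bound:
  assumes "0 \<le> s" "s \<in> \<rat>"
  obtains n C where "n > 0" "C > 0"
    "\<And>(A :: (real^'d::finite^'d)^'m::finite) N. A \<in> contracting_tuples \<Longrightarrow> summable (model_sum A s) \<Longrightarrow>
       model_sum A s (N * n) \<le> C * model_sum A s N ^ (n - 1)"
proof -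
  obtain g p where g: "rep_norm g" "0 < p"
    "\<And>B :: real^'d^'d. invertible B \<Longrightarrow> svf_model s B = g B powr p"
    by (rule svf_model_eq_rep_norm_powr[OF assms, where 'd = 'd]) (rule that)
  obtain n R where R: "n > 0" "\<And>i j. continuous_on UNIV (\<lambda>B. R B i j)"
    "\<And>A B i j. i < n \<Longrightarrow> j < n \<Longrightarrow> R (A ** B) i j = (\<Sum>k<n. R A i k * R B k j)"
    "\<And>B. g B = entry_norm n (R B)" by (rule rep_normE[OF g(1)]) (rule that)
  obtain C where C: "C > 0" "\<And>(X :: 'm list \<Rightarrow> nat \<Rightarrow> nat \<Rightarrow> real) N.
     cocycle n X \<Longrightarrow> summable (word_sum (\<lambda>w. entry_norm n (X w) powr p)) \<Longrightarrow>
     word_sum (\<lambda>w. entry_norm n (X w) powr p) (N * n)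
       \<le> C * word_sum (\<lambda>w. entry_norm n (X w) powr p) N ^ (n - 1)"
    using word_sum_power_le_of_summable[OF g(2) R(1), where 'm = 'm] by auto
  show thesis
  proof (rule that[OF R(1) C(1)])
    fix A :: "(real^'d^'d)^'m" and N
    assume A: "A \<in> contracting_tuples" and sm: "summable (model_sum A s)"
    have "cocycle n (\<lambda>w. R (word_prod A w))"
      by (simp add: cocycle_def word_prod_append R(3))
    moreover have "word_sum (\<lambda>w. entry_norm n (R (word_prod A w)) powr p) = model_sum A s"
      unfolding model_sum_def by (simp add: g(3) invertible_word[OF A] R(4))
    ultimately show "model_sum A s (N * n) \<le> C * model_sum A s N ^ (n - 1)"
      using C(2)[of "\<lambda>w. R (word_prod A w)" N] sm by simp
  qed
qed

lemma continuous_on_affinity_dimension: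
  assumes m: "CARD('m::finite) \<ge> 2"
  shows "continuous_on (contracting_tuples :: ((real^'d::finite^'d)^'m) set) affinity_dimension"
  unfolding continuous_on_def
proof (intro ballI order_tendstoI)
  fix A :: "(real^'d^'d)^'m" and a :: real
  assume A: "A \<in> contracting_tuples"
  let ?F = "at A within contracting_tuples"
  have in_C: "\<forall>\<^sub>F A' in ?F. A' \<in> contracting_tuples" by (simp add: eventually_at_filter)
  have cont: "((\<lambda>A'. model_sum A' s k) \<longlongrightarrow> model_sum A s k) ?F" if "0 \<le> s" "s \<in> \<rat>" for s k
    using continuous_on_model_sum[OF that, of k] A by (auto simp: continuous_on_def)
  {
    assume "a < affinity_dimension A"
    then have "max a 0 < affinity_dimension A"
      using affinity_dimension_zero(1)[OF A m] by simp
    from Rats_dense_in_real[OF this] obtain s where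
      s: "s \<in> \<rat>" "a < s" "0 < s" "s < affinity_dimension A" by auto
    then have s0: "0 \<le> s" by simp
    obtain n C where n: "n > 0" "C > 0" and bound:
      "\<And>(A' :: (real^'d^'d)^'m) N. A' \<in> contracting_tuples \<Longrightarrow> summable (model_sum A' s) \<Longrightarrow>
         model_sum A' s (N * n) \<le> C * model_sum A' s N ^ (n - 1)"
      by (rule ex_model_sum_power_bound[OF s0 s(1), where 'd = 'd and 'm = 'm]) (rule that)
    have "0 < svf_pressure A s" using affinity_dimension_less_iff(2)[OF A m s0] s by simp
    from ex_model_sum_power_less[OF A s0 this n] obtain N where
      N: "C * model_sum A s N ^ (n - 1) < model_sum A s (N * n)" by blast
    have "((\<lambda>A'. model_sum A' s (N * n) - C * model_sum A' s N ^ (n - 1))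
        \<longlongrightarrow> model_sum A s (N * n) - C * model_sum A s N ^ (n - 1)) ?F"
      by (intro tendsto_intros cont s0 s(1))
    then have "\<forall>\<^sub>F A' in ?F. 0 < model_sum A' s (N * n) - C * model_sum A' s N ^ (n - 1)"
      by (rule order_tendstoD(1)) (use N in simp)
    then show "\<forall>\<^sub>F A' in ?F. a < affinity_dimension A'"
      using in_C
    proof eventually_elim
      case (elim A')
      \<comment> \<open>Otherwise \<open>A'\<close> has negative pressure at \<open>s\<close> and obeys the power bound, contrary to the strict
        inequality carried over from \<open>A\<close>.\<close>
      have "\<not> affinity_dimension A' < s"
      proof
        assume "affinity_dimension A' < s"
        then have "svf_pressure A' s < 0" using affinity_dimension_less_iff(1)[OF elim(2) m s0] by simp
        then have "summable (model_sum A' s)"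
          by (rule summable_model_sum_of_negative_pressure[OF elim(2) s0])
        then show False using bound[OF elim(2), of N] elim(1) by simp
      qed
      then show ?case using s by simp
    qed
  }
  {
    assume "affinity_dimension A < a"
    from Rats_dense_in_real[OF this] obtain s where
      s: "s \<in> \<rat>" "affinity_dimension A < s" "s < a" by auto
    then have s0: "0 \<le> s" using affinity_dimension_zero(1)[OF A m] by simp
    have "svf_pressure A s < 0" using affinity_dimension_less_iff(1)[OF A m s0] s by simp
    then have "\<forall>\<^sub>F n in sequentially. ln (model_sum A s n) / real n < 0"
      by (rule order_tendstoD(2)[OF pressure_limits(2)[OF A s0]])
    then have "\<forall>\<^sub>F n in sequentially. 0 < n \<and> ln (model_sum A s n) / real n < 0"
      using eventually_gt_at_top[of 0] by eventually_elim auto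
    then obtain N where N: "N > 0" "ln (model_sum A s N) / real N < 0"
      by (auto dest: eventually_happens)
    then have "model_sum A s N < 1"
      using model_sum_pos[OF A s0, of N] by (simp add: divide_less_0_iff ln_less_zero_iff)
    then have "\<forall>\<^sub>F A' in ?F. model_sum A' s N < 1"
      by (rule order_tendstoD(2)[OF cont[OF s0 s(1)]])
    then show "\<forall>\<^sub>F A' in ?F. affinity_dimension A' < a"
      using in_C
    proof eventually_elim
      case (elim A')
      have "svf_pressure A' s \<le> ln (model_sum A' s N) / real N"
        using pressure_limits(3)[OF elim(2) s0, of N] N by simp
      also have "\<dots> < 0"
        using elim(1) model_sum_pos[OF elim(2) s0, of N] N by (simp add: divide_less_0_iff)
      finally show ?case using affinity_dimension_less_iff(1)[OF elim(2) m s0] s by simp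
    qed
  }
qed

theorem theorem1p1:
  assumes "CARD('m::finite) \<ge> 2"
  shows "continuous_map
           (top_of_set (contracting_tuples :: ((real ^ 'd::finite ^ 'd) ^ 'm) set))
           (top_of_set {0<..})
           affinity_dimension"
  using continuous_on_affinity_dimension[OF assms, where 'd = 'd] affinity_dimension_zero(1)[OF _ assms]
  by (auto simp: continuous_map_in_subtopology)

end
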